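(* Let $\mathcal{F}$ be an ordered field and $\mathcal{R}$ its real closure. If $\mathcal{F}_1,\mathcal{F}_2$ are different fields satisfying $\mathcal{F}\subset\mathcal{F}_1\subset\mathcal{R}$ and $\mathcal{F}\subset\mathcal{F}_2\subset\mathcal{R}$, then there is a nonnegative matrix $A$ over $\mathcal{F}$ such that $\operatorname{Rank}_+(A,\mathcal{F}_1)\neq\operatorname{Rank}_+(A,\mathcal{F}_2)$.
   Context: A matrix is nonnegative if all its entries are nonnegative. A nonnegative $k$-factorization of a nonnegative matrix $A$ over $\mathcal{F}$ is a family $(A_1,\ldots,A_k)$ of rank-one matrices with nonnegative entries in $\mathcal{R}$ such that $A_1+\cdots+A_k=A$; $\operatorname{fact}_+(A,k)$ is the set of all such factorizations with $A_1\succ\cdots\succ A_k$, where $\succ$ is the lexicographic ordering on matrices. For a field $\mathcal{F}'$ with $\mathcal{F}\subset\mathcal{F}'\subset\mathcal{R}$, the nonnegative rank $\operatorname{Rank}_+(A,\mathcal{F}')$ of $A$ with respect to $\mathcal{F}'$ is the smallest $k$ such that $\operatorname{fact}_+(A,k)$ contains a point with coordinates in $\mathcal{F}'$, i.e. a factorization in which all matrices $A_i$ have entries in $\mathcal{F}'$. *)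

theory Defs
  imports
    "HOL-Computational_Algebra.Polynomial"
    "Jordan_Normal_Form.Matrix"
    "Jordan_Normal_Form.DL_Rank"
begin

definition is_subfield :: "'a::field set \<Rightarrow> bool" where
  "is_subfield K \<longleftrightarrow>
     0 \<in> K \<and> 1 \<in> K \<and>
     (\<forall>x\<in>K. \<forall>y\<in>K. x + y \<in> K \<and> x * y \<in> K) \<and>
     (\<forall>x\<in>K. - x \<in> K \<and> inverse x \<in> K)"

definition real_closed_field :: "'a::linordered_field itself \<Rightarrow> bool" where
  "real_closed_field TYPE('a) \<longleftrightarrow>
     (\<forall>x::'a. 0 \<le> x \<longrightarrow> (\<exists>y. y\<^sup>2 = x)) \<and>
     (\<forall>p::'a poly. odd (degree p) \<longrightarrow> (\<exists>x. poly p x = 0))"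

definition algebraic_over :: "'a::field set \<Rightarrow> 'a \<Rightarrow> bool" where
  "algebraic_over K x \<longleftrightarrow> (\<exists>p. p \<noteq> 0 \<and> (\<forall>i. coeff p i \<in> K) \<and> poly p x = 0)"

(* The real closure is the ordered field given by the whole type 'a; the ordered base
   field is the subset F with the inherited order, so the condition that the order of
   the closure extends that of F is built in. *)
definition has_real_closure_UNIV :: "'a::linordered_field set \<Rightarrow> bool" where
  "has_real_closure_UNIV F \<longleftrightarrow>
     is_subfield F \<and> real_closed_field TYPE('a) \<and> (\<forall>x::'a. algebraic_over F x)"

definition matrix_over :: "'a set \<Rightarrow> 'a mat \<Rightarrow> bool" where
  "matrix_over K A \<longleftrightarrow> elements_mat A \<subseteq> K"

definition nonneg_matrix :: "'a::linordered_field mat \<Rightarrow> bool" where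
  "nonneg_matrix A \<longleftrightarrow> (\<forall>a\<in>elements_mat A. 0 \<le> a)"

(* vec_space.rank n is the dimension of the column space inside the n-dimensional
   coordinate space, hence the row dimension as first argument. *)
definition rank_one :: "'a::field mat \<Rightarrow> bool" where
  "rank_one A \<longleftrightarrow> vec_space.rank (dim_row A) A = 1"

(* The entries are compared in the order (0,0), (0,1), ..., row by row. *)
definition lex_greater :: "'a::linordered_field mat \<Rightarrow> 'a mat \<Rightarrow> bool" where
  "lex_greater B C \<longleftrightarrow>
     (concat (mat_to_list C), concat (mat_to_list B)) \<in> lexord {(x, y). x < y}"

definition nonneg_factorization :: "'a::linordered_field mat \<Rightarrow> 'a mat list \<Rightarrow> bool" where
  "nonneg_factorization A Bs \<longleftrightarrow>
     (\<forall>B\<in>set Bs. B \<in> carrier_mat (dim_row A) (dim_col A) \<and> nonneg_matrix B \<and> rank_one B) \<and>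
     foldr (+) Bs (0\<^sub>m (dim_row A) (dim_col A)) = A"

definition fact_plus :: "'a::linordered_field mat \<Rightarrow> nat \<Rightarrow> 'a mat list set" where
  "fact_plus A k =
     {Bs. length Bs = k \<and> nonneg_factorization A Bs \<and> sorted_wrt lex_greater Bs}"

(* If A is a nonnegative matrix over a subfield K, the minimum is attained: the nonzero
   terms A $$ (i,j) * E_ij, suitably ordered, form a factorization over K. *)
definition nonneg_rank :: "'a::linordered_field mat \<Rightarrow> 'a set \<Rightarrow> nat" where
  "nonneg_rank A K = (LEAST k. \<exists>Bs\<in>fact_plus A k. \<forall>B\<in>set Bs. matrix_over K B)"

end

(* Let b lie in exactly one of the two fields, say in F1, and let 0 <= b <= 1. If p is a nonzero
   polynomial over F with p(b) = 0, then by Thom's lemma b is the only element satisfying p = 0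
   together with the weak sign conditions that b imposes on the derivatives of p. Finitely many
   polynomial inequalities over F in one variable from [0, 1] can be encoded in a matrix A over F
   and a number N in such a way that, for every field K above F, A has nonnegative rank at most N
   over K if and only if the inequalities have a solution in K. Hence the rank of A is at most N
   over F1 and larger than N over F2.

   The encoding has two layers. A partially specified matrix containing an identity block of size k
   forces every factorization of size k to be a product of two matrices which are themselves blocks
   of the completion; unspecified entries then serve as variables, and each prescribed entry is a
   bilinear equation between them. An unspecified entry with an upper bound is simulated by bordering
   the matrix with a cyclic 4 x 4 block. *)

theory Submission
  imports Defs "HOL-Library.List_Lexorder"
begin

subsection \<open>Subfields\<close>

lemma subfield_minus:
  assumes "is_subfield K" "x \<in> K" "y \<in> K" shows "x - y \<in> K"
  using assms unfolding is_subfield_def by (metis diff_conv_add_uminus)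

lemma subfield_divide:
  assumes "is_subfield K" "x \<in> K" "y \<in> K" shows "x / y \<in> K"
  using assms unfolding is_subfield_def by (metis divide_inverse)

lemma subfield_sum:
  assumes "is_subfield K" "\<And>i. i \<in> I \<Longrightarrow> f i \<in> K" shows "sum f I \<in> K"
  using assms by (induction I rule: infinite_finite_induct) (auto simp: is_subfield_def)

lemma subfield_of_nat: "is_subfield K \<Longrightarrow> of_nat n \<in> K"
  by (induction n) (auto simp: is_subfield_def)

lemma subfield_power: "is_subfield K \<Longrightarrow> x \<in> K \<Longrightarrow> x ^ n \<in> K"
  by (induction n) (auto simp: is_subfield_def)

lemma subfield_higher_pderiv:
  assumes "is_subfield K" "\<And>i. coeff p i \<in> K"
  shows "coeff ((pderiv ^^ m) p) i \<in> K"
  using assms(2)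
proof (induction m arbitrary: i)
  case (Suc m)
  then show ?case
    using assms(1) subfield_of_nat[OF assms(1)]
    by (simp add: coeff_pderiv is_subfield_def del: of_nat_Suc)
qed simp

subsection \<open>Thom's lemma\<close>

text \<open>Nonnegative combinations of Bernstein monomials. Membership certifies nonnegativity
  between \<open>a\<close> and \<open>b\<close> over any ordered field, and it passes to
  antiderivatives taken from either end by algebra alone.\<close>

inductive_set bernstein_cone :: "'a::linordered_field \<Rightarrow> 'a \<Rightarrow> 'a poly set" for a b where
  monomial: "[:-a, 1:] ^ i * [:b, -1:] ^ j \<in> bernstein_cone a b"
| add: "p \<in> bernstein_cone a b \<Longrightarrow> q \<in> bernstein_cone a b \<Longrightarrow> p + q \<in> bernstein_cone a b"
| smult: "0 \<le> c \<Longrightarrow> p \<in> bernstein_cone a b \<Longrightarrow> Polynomial.smult c p \<in> bernstein_cone a b"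

lemma bernstein_cone_nonneg:
  assumes "p \<in> bernstein_cone a b" "a \<le> x" "x \<le> b"
  shows "0 \<le> poly p x"
  using assms(1)
proof induction
  case (monomial i j)
  then show ?case using assms(2,3) by (simp add: poly_power)
qed auto

lemma bernstein_cone_const: "0 \<le> c \<Longrightarrow> [:c:] \<in> bernstein_cone a b"
  using bernstein_cone.smult[OF _ bernstein_cone.monomial[of a 0 b 0], of c] by simp

text \<open>Repeated integration by parts. The derivative of the monomial with both exponents raised
  by one contains the wanted monomial and a remainder with negative sign. The antiderivative of that
  remainder, given by induction on \<open>j\<close> with \<open>i\<close> raised by one, cancels it,
  and all coefficients stay nonnegative.\<close>

lemma bernstein_monomial_antiderivative_left:
  "\<exists>q \<in> bernstein_cone a b. pderiv q = [:-a, 1:] ^ i * [:b, -1:] ^ j \<and> poly q a = 0"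
proof (induction j arbitrary: i)
  case 0
  let ?q = "Polynomial.smult (1 / of_nat (Suc i)) ([:-a, 1:] ^ Suc i * [:b, -1:] ^ 0)"
  have "?q \<in> bernstein_cone a b"
    by (intro bernstein_cone.smult bernstein_cone.monomial) simp
  moreover have "pderiv ?q = [:-a, 1:] ^ i * [:b, -1:] ^ 0" "poly ?q a = 0"
    unfolding power_0 mult_1_right pderiv_smult pderiv_power_Suc
    by (simp_all add: pderiv_pCons del: of_nat_Suc)
  ultimately show ?case by blast
next
  case (Suc j)
  obtain r where r: "r \<in> bernstein_cone a b"
      "pderiv r = [:-a, 1:] ^ Suc i * [:b, -1:] ^ j" "poly r a = 0"
    using Suc.IH by blast
  let ?m = "[:-a, 1:] ^ Suc i * [:b, -1:] ^ Suc j"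
  let ?q = "Polynomial.smult (1 / of_nat (Suc i)) (?m + Polynomial.smult (of_nat (Suc j)) r)"
  have "?q \<in> bernstein_cone a b"
    by (intro bernstein_cone.smult bernstein_cone.add bernstein_cone.monomial r) simp_all
  moreover have "pderiv ?m = Polynomial.smult (of_nat (Suc i)) ([:-a, 1:] ^ i * [:b, -1:] ^ Suc j)
      - Polynomial.smult (of_nat (Suc j)) ([:-a, 1:] ^ Suc i * [:b, -1:] ^ j)"
    unfolding pderiv_mult pderiv_power_Suc
    by (simp add: pderiv_pCons mult.commute del: power_Suc of_nat_Suc)
  then have "pderiv ?q = [:-a, 1:] ^ i * [:b, -1:] ^ Suc j"
    by (simp add: pderiv_smult pderiv_add r(2) del: power_Suc of_nat_Suc)
  moreover have "poly ?q a = 0"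
    by (simp add: r(3))
  ultimately show ?case by blast
qed

lemma bernstein_cone_antiderivative_left:
  assumes "p \<in> bernstein_cone a b"
  shows "\<exists>q \<in> bernstein_cone a b. pderiv q = p \<and> poly q a = 0"
  using assms
proof induction
  case (monomial i j)
  then show ?case by (rule bernstein_monomial_antiderivative_left)
next
  case (add p p')
  then show ?case by (metis bernstein_cone.add pderiv_add poly_add add.right_neutral)
next
  case (smult c p)
  then show ?case by (metis bernstein_cone.smult pderiv_smult poly_smult mult_zero_right)
qed

lemma pcompose_power_left: "pcompose (p ^ n) q = pcompose p q ^ n" for p q :: "'a::comm_ring_1 poly"
  by (induction n) (simp_all add: pcompose_mult pcompose_1)

text \<open>Replacing \<open>x\<close> by \<open>-x\<close> exchanges the two factors of a monomial,
  so integration from the right end reduces to integration from the left end.\<close>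

lemma bernstein_cone_reflect:
  assumes "p \<in> bernstein_cone a b"
  shows "pcompose p [:0, -1:] \<in> bernstein_cone (-b) (-a)"
  using assms
proof induction
  case (monomial i j)
  have "pcompose ([:-a, 1:] ^ i * [:b, -1:] ^ j) [:0, -1:] = [:- (-b), 1:] ^ j * [:-a, -1:] ^ i"
    by (simp add: pcompose_mult pcompose_power_left pcompose_pCons)
  then show ?case by (metis bernstein_cone.monomial)
next
  case (add p p')
  then show ?case by (simp add: pcompose_add bernstein_cone.add)
next
  case (smult c p)
  then show ?case by (simp add: pcompose_smult bernstein_cone.smult)
qed

lemma bernstein_cone_antiderivative_right:
  assumes "p \<in> bernstein_cone a b"
  shows "\<exists>q \<in> bernstein_cone a b. pderiv q = - p \<and> poly q b = 0"
proof -
  obtain r where r: "r \<in> bernstein_cone (-b) (-a)" "pderiv r = pcompose p [:0, -1:]" "poly r (-b) = 0"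
    using bernstein_cone_antiderivative_left[OF bernstein_cone_reflect[OF assms]] by blast
  let ?q = "pcompose r [:0, -1:]"
  have "?q \<in> bernstein_cone a b"
    using bernstein_cone_reflect[OF r(1)] by simp
  moreover have "pderiv ?q = - p"
    by (simp add: pderiv_pcompose r(2) pderiv_pCons pcompose_assoc[symmetric] pcompose_pCons pcompose_idR)
  moreover have "poly ?q b = 0"
    by (simp add: poly_pcompose r(3))
  ultimately show ?thesis by blast
qed

text \<open>Each derivative is recovered from the next one by integrating from the end of the interval at
  which its absolute value is smaller. This keeps Thom's lemma free of the intermediate value theorem.\<close>

lemma sign_pattern_in_bernstein_cone:
  fixes p :: "'a::linordered_field poly"
  assumes "\<And>i. s i = 1 \<or> s i = - 1"
    and "\<And>i. 0 \<le> s i * poly ((pderiv ^^ i) p) a"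
    and "\<And>i. 0 \<le> s i * poly ((pderiv ^^ i) p) b"
  shows "Polynomial.smult (s 0) p \<in> bernstein_cone a b"
  using assms
proof (induction "degree p" arbitrary: p s rule: less_induct)
  case less
  show ?case
  proof (cases "degree p = 0")
    case True
    then obtain c where "p = [:c:]" by (metis degree_eq_zeroE)
    then show ?thesis
      using less.prems(2)[of 0] by (simp add: bernstein_cone_const)
  next
    case False
    have IH: "Polynomial.smult (s 1) (pderiv p) \<in> bernstein_cone a b"
      using less.hyps[of "pderiv p" "\<lambda>i. s (Suc i)"] less.prems(1) less.prems(2,3)[of "Suc _"] False
      by (simp add: degree_pderiv funpow_swap1)
    \<comment> \<open>The difference of \<open>Polynomial.smult (s 0) p\<close> and \<open>q\<close>
      is a constant; it is nonnegative because \<open>q\<close> vanishes at \<open>c\<close> and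
      \<open>p\<close> has the prescribed sign there.\<close>
    have const: "Polynomial.smult (s 0) p \<in> bernstein_cone a b"
      if q: "q \<in> bernstein_cone a b" "pderiv q = Polynomial.smult (s 0) (pderiv p)" "poly q c = 0"
        and c: "0 \<le> s 0 * poly p c" for q c
    proof -
      have "pderiv (Polynomial.smult (s 0) p - q) = 0"
        using q(2) by (simp add: pderiv_diff pderiv_smult)
      then obtain d where d: "Polynomial.smult (s 0) p - q = [:d:]"
        by (metis pderiv_eq_0_iff degree_eq_zeroE)
      have "d = poly (Polynomial.smult (s 0) p - q) c" by (simp add: d)
      then have "0 \<le> d" using c q(3) by simp
      moreover have "Polynomial.smult (s 0) p = q + [:d:]" using d by (simp add: algebra_simps)
      ultimately show ?thesis using q(1) by (simp add: bernstein_cone.add bernstein_cone_const)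
    qed
    \<comment> \<open>If the signs agree, \<open>s 0\<close> times \<open>pderiv p\<close> lies in
      the cone and integration starts at \<open>a\<close>; if they differ, its negative does and
      integration starts at \<open>b\<close>.\<close>
    consider "s 1 = s 0" | "s 0 = - s 1"
      using less.prems(1)[of 0] less.prems(1)[of 1] by fastforce
    then show ?thesis
    proof cases
      case 1
      then show ?thesis
        using bernstein_cone_antiderivative_left[OF IH] const[of _ a] less.prems(2)[of 0] by auto
    next
      case 2
      then show ?thesis
        using bernstein_cone_antiderivative_right[OF IH] const[of _ b] less.prems(3)[of 0] by auto
    qed
  qed
qed

text \<open>As \<open>p\<close> vanishes at both points, the sign at index 0 can be chosen freely,
  so \<open>p\<close> and its negative both lie in the cone. Hence \<open>p\<close> vanishes on the
  whole interval, which is infinite if the points differ.\<close>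

lemma thom_unique_root:
  fixes p :: "'a::linordered_field poly"
  assumes "p \<noteq> 0" "\<And>i. s i = 1 \<or> s i = - 1"
    and "poly p a = 0" "poly p b = 0"
    and "\<And>i. 0 \<le> s i * poly ((pderiv ^^ i) p) a"
    and "\<And>i. 0 \<le> s i * poly ((pderiv ^^ i) p) b"
  shows "a = b"
proof -
  have False if *: "a < b" "poly p a = 0" "poly p b = 0"
    "\<And>i. 0 \<le> s i * poly ((pderiv ^^ i) p) a"
    "\<And>i. 0 \<le> s i * poly ((pderiv ^^ i) p) b" for a b
  proof -
    have cone: "Polynomial.smult e p \<in> bernstein_cone a b" if "e = 1 \<or> e = - 1" for e
      using sign_pattern_in_bernstein_cone[of "s(0 := e)" p a b] assms(2) * that
      by (auto simp: fun_upd_def)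
    have "poly p x = 0" if "x \<in> {a..b}" for x
      using bernstein_cone_nonneg[OF cone[of 1], of x] bernstein_cone_nonneg[OF cone[of "- 1"], of x] that
      by (auto intro: antisym)
    then have "{a..b} \<subseteq> {x. poly p x = 0}" by auto
    then have "finite {a..b}" using poly_roots_finite[OF assms(1)] finite_subset by blast
    then show False using infinite_Icc[OF \<open>a < b\<close>] by simp
  qed
  from this[of a b] this[of b a] assms(3-) show ?thesis by (meson linorder_cases)
qed

subsection \<open>Nonnegative rank and outer products\<close>

text \<open>Zero and repeated terms are allowed, so that the predicate is monotone in \<open>k\<close>.\<close>

definition nonneg_fac ::
  "'a::linordered_field set \<Rightarrow> 'i set \<Rightarrow> 'j set \<Rightarrow> ('i \<Rightarrow> 'j \<Rightarrow> 'a) \<Rightarrow> nat \<Rightarrow> bool" where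
  "nonneg_fac K I J A k \<longleftrightarrow>
     (\<exists>f g. (\<forall>t<k. (\<forall>i\<in>I. f t i \<in> K \<and> 0 \<le> f t i) \<and> (\<forall>j\<in>J. g t j \<in> K \<and> 0 \<le> g t j)) \<and>
            (\<forall>i\<in>I. \<forall>j\<in>J. A i j = (\<Sum>t<k. f t i * g t j)))"

lemma nonneg_facE:
  assumes "nonneg_fac K I J A k"
  obtains f g where
    "\<And>t i. t < k \<Longrightarrow> i \<in> I \<Longrightarrow> f t i \<in> K \<and> 0 \<le> f t i"
    "\<And>t j. t < k \<Longrightarrow> j \<in> J \<Longrightarrow> g t j \<in> K \<and> 0 \<le> g t j"
    "\<And>i j. i \<in> I \<Longrightarrow> j \<in> J \<Longrightarrow> A i j = (\<Sum>t<k. f t i * g t j)"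
  using assms unfolding nonneg_fac_def by blast

text \<open>Allows any finite index set with at most \<open>k\<close> elements; the missing terms
  are filled with zeros.\<close>

lemma nonneg_facI:
  assumes K: "is_subfield K" and T: "finite T" "card T \<le> k"
    and f: "\<And>t i. t \<in> T \<Longrightarrow> i \<in> I \<Longrightarrow> f t i \<in> K \<and> 0 \<le> f t i"
    and g: "\<And>t j. t \<in> T \<Longrightarrow> j \<in> J \<Longrightarrow> g t j \<in> K \<and> 0 \<le> g t j"
    and A: "\<And>i j. i \<in> I \<Longrightarrow> j \<in> J \<Longrightarrow> A i j = (\<Sum>t\<in>T. f t i * g t j)"
  shows "nonneg_fac K I J A k"
proof -
  obtain h where h: "bij_betw h {..<card T} T"
    using ex_bij_betw_nat_finite[OF T(1)] by (auto simp: atLeast0LessThan)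
  define f' where "f' t i = (if t < card T then f (h t) i else 0)" for t i
  define g' where "g' t j = (if t < card T then g (h t) j else 0)" for t j
  have hT: "h t \<in> T" if "t < card T" for t
    using h that by (auto simp: bij_betw_def)
  have "0 \<in> K" using K by (simp add: is_subfield_def)
  moreover have "A i j = (\<Sum>t<k. f' t i * g' t j)" if "i \<in> I" "j \<in> J" for i j
  proof -
    have "A i j = (\<Sum>t<card T. f (h t) i * g (h t) j)"
      unfolding A[OF that] by (rule sum.reindex_bij_betw[OF h, symmetric])
    also have "\<dots> = (\<Sum>t<k. f' t i * g' t j)"
      using T(2) by (intro sum.mono_neutral_cong_left) (auto simp: f'_def g'_def)
    finally show ?thesis .
  qed
  ultimately show ?thesis
    unfolding nonneg_fac_def using f g hT
    by (intro exI[of _ f'] exI[of _ g']) (auto simp: f'_def g'_def)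
qed

lemma nonneg_fac_mono:
  assumes "is_subfield K" "nonneg_fac K I J A k" "k \<le> l"
  shows "nonneg_fac K I J A l"
  using assms(2)
proof (rule nonneg_facE)
  fix f g
  assume "\<And>t i. t < k \<Longrightarrow> i \<in> I \<Longrightarrow> f t i \<in> K \<and> 0 \<le> f t i"
    "\<And>t j. t < k \<Longrightarrow> j \<in> J \<Longrightarrow> g t j \<in> K \<and> 0 \<le> g t j"
    "\<And>i j. i \<in> I \<Longrightarrow> j \<in> J \<Longrightarrow> A i j = (\<Sum>t<k. f t i * g t j)"
  then show ?thesis
    using assms(1,3) by (intro nonneg_facI[of K "{..<k}" _ _ f _ g]) auto
qed

lemma nonneg_fac_reindex:
  assumes "nonneg_fac K I J A k" "\<And>i. i \<in> I' \<Longrightarrow> e i \<in> I" "\<And>j. j \<in> J' \<Longrightarrow> e' j \<in> J"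
    and "\<And>i j. i \<in> I' \<Longrightarrow> j \<in> J' \<Longrightarrow> A' i j = A (e i) (e' j)"
  shows "nonneg_fac K I' J' A' k"
  using assms(1)
proof (rule nonneg_facE)
  fix f g
  assume "\<And>t i. t < k \<Longrightarrow> i \<in> I \<Longrightarrow> f t i \<in> K \<and> 0 \<le> f t i"
    "\<And>t j. t < k \<Longrightarrow> j \<in> J \<Longrightarrow> g t j \<in> K \<and> 0 \<le> g t j"
    "\<And>i j. i \<in> I \<Longrightarrow> j \<in> J \<Longrightarrow> A i j = (\<Sum>t<k. f t i * g t j)"
  then show ?thesis
    using assms(2-) unfolding nonneg_fac_def
    by (intro exI[of _ "\<lambda>t. f t \<circ> e"] exI[of _ "\<lambda>t. g t \<circ> e'"]) auto
qed

section \<open>Rank-one matrices as outer products\<close>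

text \<open>Two distinct columns satisfy a nontrivial linear relation, and the minor multiplied by
  either coefficient of the relation is zero.\<close>

lemma (in vec_space) rank_le_1_minor:
  assumes B: "B \<in> carrier_mat n m" and "rank B \<le> 1" and "i < n" "p < n" "j < m" "q < m"
  shows "B $$ (i, j) * B $$ (p, q) = B $$ (i, q) * B $$ (p, j)"
\<comment> \<open>Equal columns form a set with one element, for which the rank bound yields no
  relation.\<close>
proof (cases "col B j = col B q")
  case True
  then have "B $$ (r, j) = B $$ (r, q)" if "r < n" for r
    using assms that by (metis carrier_matD index_col)
  then show ?thesis using assms by simp
next
  case False
  let ?cs = "[col B j, col B q]"
  let ?C = "mat_of_cols n ?cs"
  have cs: "set ?cs \<subseteq> carrier_vec n" using B by auto
  then have cols: "cols ?C = ?cs" by (rule cols_mat_of_cols)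
  have "set ?cs \<subseteq> set (cols B)"
    using assms by (auto simp: cols_def)
  then have "lin_dep (set ?cs)"
    using rank_ge_card_indpt[OF B, of "set ?cs"] assms(2) False by auto
  moreover have C: "?C \<in> carrier_mat n 2"
    using mat_of_cols_carrier(1)[of n ?cs] by (simp add: numeral_2_eq_2)
  moreover have "distinct (cols ?C)"
    using False cols by simp
  ultimately obtain v where v: "v \<in> carrier_vec 2" "v \<noteq> 0\<^sub>v 2" "?C *\<^sub>v v = 0\<^sub>v n"
    using lin_depE[of ?C 2] cols by metis
  have rel: "B $$ (r, j) * v $ 0 + B $$ (r, q) * v $ 1 = 0" if "r < n" for r
  proof -
    have "(?C *\<^sub>v v) $ r = 0" using v(3) that by simp
    then show ?thesis
      using v(1) that assms by (simp add: scalar_prod_def mat_of_cols_def numeral_2_eq_2)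
  qed
  have "v $ 0 \<noteq> 0 \<or> v $ 1 \<noteq> 0"
    using v(1,2) by (auto simp: less_2_cases_iff)
  moreover have "v $ 0 * (B $$ (i, j) * B $$ (p, q) - B $$ (i, q) * B $$ (p, j)) = 0"
  proof -
    have "v $ 0 * (B $$ (i, j) * B $$ (p, q) - B $$ (i, q) * B $$ (p, j)) =
        B $$ (p, q) * (B $$ (i, j) * v $ 0 + B $$ (i, q) * v $ 1)
        - B $$ (i, q) * (B $$ (p, j) * v $ 0 + B $$ (p, q) * v $ 1)"
      by (simp add: algebra_simps)
    then show ?thesis by (simp only: rel \<open>i < n\<close> \<open>p < n\<close>) simp
  qed
  moreover have "v $ 1 * (B $$ (i, j) * B $$ (p, q) - B $$ (i, q) * B $$ (p, j)) = 0"
  proof -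
    have "v $ 1 * (B $$ (i, j) * B $$ (p, q) - B $$ (i, q) * B $$ (p, j)) =
        B $$ (i, j) * (B $$ (p, j) * v $ 0 + B $$ (p, q) * v $ 1)
        - B $$ (p, j) * (B $$ (i, j) * v $ 0 + B $$ (i, q) * v $ 1)"
      by (simp add: algebra_simps)
    then show ?thesis by (simp only: rel \<open>i < n\<close> \<open>p < n\<close>) simp
  qed
  ultimately show ?thesis by auto
qed

lemma (in vec_space) rank_pos:
  assumes B: "B \<in> carrier_mat n m" and "p < n" "q < m" "B $$ (p, q) \<noteq> 0"
  shows "1 \<le> rank B"
proof -
  let ?cs = "[col B q]"
  let ?C = "mat_of_cols n ?cs"
  have cs: "set ?cs \<subseteq> carrier_vec n" using B by auto
  then have cols: "cols ?C = ?cs" by (rule cols_mat_of_cols)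
  have "lin_indpt (set ?cs)"
  proof
    assume "lin_dep (set ?cs)"
    moreover have C: "?C \<in> carrier_mat n 1"
      using mat_of_cols_carrier(1)[of n ?cs] by simp
    moreover have "distinct (cols ?C)"
      using cols by simp
    ultimately obtain v where v: "v \<in> carrier_vec 1" "v \<noteq> 0\<^sub>v 1" "?C *\<^sub>v v = 0\<^sub>v n"
      using lin_depE[of ?C 1] cols by metis
    have "(?C *\<^sub>v v) $ p = 0" using v(3) assms by simp
    then have "v $ 0 = 0"
      using v(1) assms by (simp add: scalar_prod_def mat_of_cols_def)
    with v(1,2) show False by auto
  qed
  moreover have "set ?cs \<subseteq> set (cols B)"
    using assms by (auto simp: cols_def)
  ultimately show ?thesis
    using rank_ge_card_indpt[OF B, of "set ?cs"] by simp
qed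

text \<open>A nonzero entry serves as pivot: its column, times its row divided by the pivot,
  reproduces the matrix because the minors vanish. Both factors inherit nonnegativity, and the
  division stays in \<open>K\<close>.\<close>

lemma rank_one_factors:
  fixes B :: "'a::linordered_field mat"
  assumes "is_subfield K" "B \<in> carrier_mat n m" "rank_one B" "nonneg_matrix B" "matrix_over K B"
  obtains f g where "\<And>i. i < n \<Longrightarrow> f i \<in> K \<and> 0 \<le> f i" "\<And>j. j < m \<Longrightarrow> g j \<in> K \<and> 0 \<le> g j"
    "\<And>i j. i < n \<Longrightarrow> j < m \<Longrightarrow> B $$ (i, j) = f i * g j"
proof -
  interpret vec_space "TYPE('a)" n .
  have B: "B $$ (i, j) \<in> K" "0 \<le> B $$ (i, j)" if "i < n" "j < m" for i j
    using assms(2,4,5) that by (auto simp: matrix_over_def nonneg_matrix_def)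
  have rank: "rank B = 1" using assms(2,3) by (simp add: rank_one_def)
  then have "B \<noteq> 0\<^sub>m n m" using rank_0I by auto
  then obtain p q where pq: "p < n" "q < m" "B $$ (p, q) \<noteq> 0"
    using assms(2) by (auto simp: mat_eq_iff)
  show ?thesis
  proof (rule that[of "\<lambda>i. B $$ (i, q)" "\<lambda>j. B $$ (p, j) / B $$ (p, q)"])
    show "B $$ (i, j) = B $$ (i, q) * (B $$ (p, j) / B $$ (p, q))" if "i < n" "j < m" for i j
      using rank_le_1_minor[OF assms(2) _ that(1) pq(1) that(2) pq(2)] pq(3) rank
      by (simp add: field_simps)
  qed (use B pq subfield_divide[OF assms(1)] in auto)
qed

lemma rank_one_outer_product:
  fixes f g :: "nat \<Rightarrow> 'a::linordered_field"
  assumes "mat n m (\<lambda>(i, j). f i * g j) \<noteq> 0\<^sub>m n m"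
  shows "rank_one (mat n m (\<lambda>(i, j). f i * g j))" (is "rank_one ?B")
proof -
  interpret vec_space "TYPE('a)" n .
  obtain p q where pq: "p < n" "q < m" "?B $$ (p, q) \<noteq> 0"
    using assms by (auto simp: mat_eq_iff)
  have "1 \<le> rank ?B" using rank_pos[OF _ pq] by simp
  moreover have "rank ?B \<le> 1" by (rule rank_le_1_product_entries[of _ m f g]) auto
  ultimately show ?thesis by (simp add: rank_one_def)
qed

section \<open>Lexicographically sorted factorizations\<close>

lemma foldr_add_mat:
  assumes "\<forall>B\<in>set Bs. B \<in> carrier_mat n m"
  shows "foldr (+) Bs (0\<^sub>m n m) =
    mat n m (\<lambda>(i, j). \<Sum>B\<leftarrow>Bs. B $$ (i, j) :: 'a::linordered_field)"
  using assms by (induction Bs) (auto intro!: eq_matI)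

lemma fact_plus_imp_nonneg_fac:
  assumes K: "is_subfield K" and Bs: "Bs \<in> fact_plus A k" "\<forall>B\<in>set Bs. matrix_over K B"
  shows "nonneg_fac K {..<dim_row A} {..<dim_col A} (\<lambda>i j. A $$ (i, j)) k"
proof -
  have len: "length Bs = k"
    and carrier: "\<forall>B\<in>set Bs. B \<in> carrier_mat (dim_row A) (dim_col A)"
    and Bs': "\<forall>B\<in>set Bs. nonneg_matrix B \<and> rank_one B"
    and A: "foldr (+) Bs (0\<^sub>m (dim_row A) (dim_col A)) = A"
    using Bs(1) by (auto simp: fact_plus_def nonneg_factorization_def)
  have "\<exists>f g. (\<forall>i<dim_row A. f i \<in> K \<and> 0 \<le> f i) \<and> (\<forall>j<dim_col A. g j \<in> K \<and> 0 \<le> g j) \<and>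
      (\<forall>i<dim_row A. \<forall>j<dim_col A. B $$ (i, j) = f i * g j)" if "B \<in> set Bs" for B
  proof -
    obtain f g where "\<And>i. i < dim_row A \<Longrightarrow> f i \<in> K \<and> 0 \<le> f i"
      "\<And>j. j < dim_col A \<Longrightarrow> g j \<in> K \<and> 0 \<le> g j"
      "\<And>i j. i < dim_row A \<Longrightarrow> j < dim_col A \<Longrightarrow> B $$ (i, j) = f i * g j"
      using rank_one_factors[OF K, of B "dim_row A" "dim_col A"] carrier Bs' Bs(2) \<open>B \<in> set Bs\<close>
      by blast
    then show ?thesis by blast
  qed
  then obtain f g where fg: "\<And>B. B \<in> set Bs \<Longrightarrow> (\<forall>i<dim_row A. f B i \<in> K \<and> 0 \<le> f B i) \<and>
      (\<forall>j<dim_col A. g B j \<in> K \<and> 0 \<le> g B j) \<and>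
      (\<forall>i<dim_row A. \<forall>j<dim_col A. B $$ (i, j) = f B i * g B j)"
    by metis
  have "A $$ (i, j) = (\<Sum>t<k. f (Bs ! t) i * g (Bs ! t) j)" if ij: "i < dim_row A" "j < dim_col A" for i j
  proof -
    have "A $$ (i, j) = (\<Sum>B\<leftarrow>Bs. B $$ (i, j))"
      by (subst A[symmetric], subst foldr_add_mat[OF carrier]) (use ij in simp)
    also have "\<dots> = (\<Sum>t<k. (Bs ! t) $$ (i, j))"
      by (simp add: sum_list_sum_nth len atLeast0LessThan)
    also have "\<dots> = (\<Sum>t<k. f (Bs ! t) i * g (Bs ! t) j)"
      using fg ij len by (intro sum.cong) auto
    finally show ?thesis .
  qed
  then show ?thesis
    unfolding nonneg_fac_def using fg len
    by (intro exI[of _ "\<lambda>t. f (Bs ! t)"] exI[of _ "\<lambda>t. g (Bs ! t)"]) auto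
qed

text \<open>Equal row lengths make the flattened entry list determine a matrix of known size, so the
  list can serve as a sort key.\<close>

lemma mat_to_list_inj:
  fixes B C :: "'a mat"
  assumes "B \<in> carrier_mat n m" "C \<in> carrier_mat n m"
    and "concat (mat_to_list B) = concat (mat_to_list C)"
  shows "B = C"
proof -
  have "mat_to_list B = mat_to_list C"
    by (rule concat_injective[OF assms(3)])
      (use assms in \<open>auto simp: mat_to_list_def set_zip\<close>)
  moreover have "D $$ (i, j) = mat_to_list D ! i ! j"
    if "D \<in> carrier_mat n m" "i < n" "j < m" for D :: "'a mat" and i j
    using that by (simp add: mat_to_list_def)
  ultimately show ?thesis
    using assms(1,2) by (intro eq_matI) (metis carrier_matD)+
qed

text \<open>Injectivity of \<open>B\<close> matters because \<open>lex_greater\<close> is strict.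
  The flattened lists are sorted in the lexicographic order and carried back to matrices by the
  inverse of the key.\<close>

lemma sorted_nonneg_factorization:
  assumes "finite T" "inj_on B T" "\<And>t. t \<in> T \<Longrightarrow> B t \<in> carrier_mat (dim_row A) (dim_col A)"
    and "\<And>t. t \<in> T \<Longrightarrow> nonneg_matrix (B t)" "\<And>t. t \<in> T \<Longrightarrow> rank_one (B t)"
    and "\<And>i j. i < dim_row A \<Longrightarrow> j < dim_col A \<Longrightarrow> A $$ (i, j) = (\<Sum>t\<in>T. B t $$ (i, j))"
  shows "\<exists>Bs \<in> fact_plus A (card T). set Bs = B ` T"
proof -
  let ?key = "\<lambda>B. concat (mat_to_list B)"
  have inj: "inj_on ?key (B ` T)"
    using assms(3) by (intro inj_onI) (auto intro: mat_to_list_inj)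
  define Ls where "Ls = sorted_list_of_set (?key ` B ` T)"
  \<comment> \<open>\<open>Ls\<close> is increasing, whereas a factorization has to be decreasing;
    hence \<open>rev\<close>.\<close>
  define Bs where "Bs = rev (map (the_inv_into (B ` T) ?key) Ls)"
  have inv: "the_inv_into (B ` T) ?key (?key C) = C" if "C \<in> B ` T" for C
    using the_inv_into_f_f[OF inj that] .
  have keyinv: "?key (the_inv_into (B ` T) ?key l) = l" if "l \<in> set Ls" for l
    using that assms(1) by (auto simp: Ls_def inv)
  have setLs: "set Ls = ?key ` B ` T" using assms(1) by (simp add: Ls_def)
  have "set Bs = (\<lambda>C. the_inv_into (B ` T) ?key (?key C)) ` (B ` T)"
    by (simp only: Bs_def set_rev set_map setLs image_image)
  also have "\<dots> = (\<lambda>C. C) ` (B ` T)"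
    by (rule image_cong[OF refl]) (rule inv)
  finally have set: "set Bs = B ` T" by simp
  have len: "length Bs = card T"
    using assms(1) by (simp add: Bs_def Ls_def card_image[OF inj] card_image[OF assms(2)])
  then have dist: "distinct Bs"
    using set card_image[OF assms(2)] by (metis card_distinct)
  have "sorted_wrt (<) Ls"
    using strict_sorted_list_of_set Ls_def by blast
  \<comment> \<open>Membership in \<open>Ls\<close> is put into the relation so that
    \<open>keyinv\<close> applies to both elements compared.\<close>
  then have "sorted_wrt (\<lambda>l l'. l \<in> set Ls \<and> l' \<in> set Ls \<and> l < l') Ls"
    by (simp add: sorted_wrt_iff_nth_less)
  then have "sorted_wrt lex_greater Bs"
    unfolding Bs_def sorted_wrt_rev sorted_wrt_map
    by (rule sorted_wrt_mono_rel[rotated]) (auto simp: lex_greater_def keyinv list_less_def)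
  moreover have "foldr (+) Bs (0\<^sub>m (dim_row A) (dim_col A)) = A"
  proof -
    have carrier: "\<forall>C\<in>set Bs. C \<in> carrier_mat (dim_row A) (dim_col A)"
      using set assms(3) by auto
    have "(\<Sum>C\<leftarrow>Bs. C $$ (i, j)) = (\<Sum>t\<in>T. B t $$ (i, j))" for i j
      using sum_list_distinct_conv_sum_set[OF dist, of "\<lambda>C. C $$ (i, j)"] set
        sum.reindex[OF assms(2), of "\<lambda>C. C $$ (i, j)"] by (simp add: o_def)
    then show ?thesis
      unfolding foldr_add_mat[OF carrier] using assms(6) by (intro eq_matI) auto
  qed
  ultimately have "Bs \<in> fact_plus A (card T)"
    using len set assms(3-5) by (auto simp: fact_plus_def nonneg_factorization_def)
  with set show ?thesis by blast
qed

lemma nonneg_fac_imp_fact_plus: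
  fixes A :: "'a::linordered_field mat"
  assumes K: "is_subfield K"
    and "nonneg_fac K {..<dim_row A} {..<dim_col A} (\<lambda>i j. A $$ (i, j)) k"
  shows "\<exists>l\<le>k. \<exists>Bs\<in>fact_plus A l. \<forall>B\<in>set Bs. matrix_over K B"
proof -
  let ?n = "dim_row A" and ?m = "dim_col A"
  let ?fac = "nonneg_fac K {..<?n} {..<?m} (\<lambda>i j. A $$ (i, j))"
  \<comment> \<open>In a shortest factorization no term vanishes and no two terms coincide.\<close>
  define l where "l = (LEAST l. ?fac l)"
  have l: "?fac l" "l \<le> k" "\<And>l'. l' < l \<Longrightarrow> \<not> ?fac l'"
    using LeastI[of ?fac k] Least_le[of ?fac k] assms(2) not_less_Least by (auto simp: l_def)
  obtain f g where f: "\<And>t i. t < l \<Longrightarrow> i < ?n \<Longrightarrow> f t i \<in> K \<and> 0 \<le> f t i"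
    and g: "\<And>t j. t < l \<Longrightarrow> j < ?m \<Longrightarrow> g t j \<in> K \<and> 0 \<le> g t j"
    and A: "\<And>i j. i < ?n \<Longrightarrow> j < ?m \<Longrightarrow> A $$ (i, j) = (\<Sum>t<l. f t i * g t j)"
    using l(1) unfolding nonneg_fac_def Ball_def lessThan_iff by blast
  define B where "B t = mat ?n ?m (\<lambda>(i, j). f t i * g t j)" for t
  have nz: "B t \<noteq> 0\<^sub>m ?n ?m" if t: "t < l" for t
  proof
    assume "B t = 0\<^sub>m ?n ?m"
    then have "f t i * g t j = 0" if "i < ?n" "j < ?m" for i j
      using that by (auto simp: B_def mat_eq_iff)
    then have "?fac (l - 1)"
      using t f g A by (intro nonneg_facI[OF K, of "{..<l} - {t}" _ _ f _ g]) (auto simp: sum.remove[of "{..<l}" t])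
    then show False using l(3)[of "l - 1"] t by simp
  qed
  have inj: "inj_on B {..<l}"
  proof (rule inj_onI, rule ccontr)
    fix s t assume st: "s \<in> {..<l}" "t \<in> {..<l}" "B s = B t" "s \<noteq> t"
    then have eq: "f s i * g s j = f t i * g t j" if "i < ?n" "j < ?m" for i j
      using that by (auto simp: B_def mat_eq_iff)
    have two: "2 * z \<in> K" if "z \<in> K" for z
      using K that unfolding is_subfield_def by (metis mult_2)
    \<comment> \<open>Two equal terms merge into one: the left factor of \<open>s\<close> is doubled
      and \<open>t\<close> is dropped.\<close>
    have "?fac (l - 1)"
    proof (rule nonneg_facI[OF K, of "{..<l} - {t}" _ _ "f(s := \<lambda>i. 2 * f s i)" _ g])
      fix i j assume ij: "i \<in> {..<?n}" "j \<in> {..<?m}"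
      have "A $$ (i, j) = f t i * g t j + (f s i * g s j + (\<Sum>u\<in>{..<l} - {t} - {s}. f u i * g u j))"
        using A[of i j] ij st by (simp add: sum.remove[of "{..<l}" t] sum.remove[of "{..<l} - {t}" s])
      also have "\<dots> = (\<Sum>u\<in>{..<l} - {t}. (f(s := \<lambda>i. 2 * f s i)) u i * g u j)"
        using eq[of i j] ij st by (simp add: sum.remove[of "{..<l} - {t}" s])
      finally show "A $$ (i, j) = (\<Sum>u\<in>{..<l} - {t}. (f(s := \<lambda>i. 2 * f s i)) u i * g u j)" .
    qed (use st f g two in auto)
    then show False using l(3)[of "l - 1"] st by simp
  qed
  have entries: "elements_mat (B t) \<subseteq> K \<inter> {0..}" if "t < l" for t
    using f[OF that] g[OF that] K by (auto simp: B_def is_subfield_def)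
  have "\<exists>Bs\<in>fact_plus A (card {..<l}). set Bs = B ` {..<l}"
  proof (rule sorted_nonneg_factorization[OF _ inj])
    show "rank_one (B t)" if "t \<in> {..<l}" for t
      using rank_one_outer_product nz that unfolding B_def by blast
    show "nonneg_matrix (B t)" if "t \<in> {..<l}" for t
      using entries that by (auto simp: nonneg_matrix_def)
  qed (use A in \<open>auto simp: B_def\<close>)
  then obtain Bs where "Bs \<in> fact_plus A l" "set Bs = B ` {..<l}" by auto
  moreover have "matrix_over K C" if "C \<in> B ` {..<l}" for C
    using entries that by (auto simp: matrix_over_def)
  ultimately show ?thesis using l(2) by blast
qed

text \<open>The factorization by rows, with unit vectors as left factors. It guarantees that the
  \<open>LEAST\<close> in \<open>nonneg_rank\<close> is attained.\<close>

lemma nonneg_fac_trivial: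
  assumes K: "is_subfield K" and "finite I" and A: "\<And>i j. i \<in> I \<Longrightarrow> j \<in> J \<Longrightarrow> A i j \<in> K \<and> 0 \<le> A i j"
  shows "nonneg_fac K I J A (card I)"
proof (rule nonneg_facI[OF K, of I _ _ "\<lambda>t i. of_bool (i = t)" _ A])
  show "A i j = (\<Sum>t\<in>I. of_bool (i = t) * A t j)" if "i \<in> I" for i j
  proof -
    have "(\<Sum>t\<in>I. of_bool (i = t) * A t j) = (\<Sum>t\<in>I. if i = t then A t j else 0)"
      by (rule sum.cong) auto
    then show ?thesis using assms(2) that by simp
  qed
qed (use assms in \<open>auto simp: is_subfield_def of_bool_def\<close>)

text \<open>The bridge to \<open>nonneg_fac\<close>: the later constructions can ignore the order of
  the terms, their ranks and the numbering of rows and columns.\<close>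

lemma nonneg_rank_le_iff:
  assumes K: "is_subfield K" and A: "matrix_over K A" "nonneg_matrix A"
  shows "nonneg_rank A K \<le> k \<longleftrightarrow> nonneg_fac K {..<dim_row A} {..<dim_col A} (\<lambda>i j. A $$ (i, j)) k"
    (is "_ \<longleftrightarrow> ?fac k")
proof
  let ?P = "\<lambda>l. \<exists>Bs\<in>fact_plus A l. \<forall>B\<in>set Bs. matrix_over K B"
  assume le: "nonneg_rank A K \<le> k"
  have "?fac (card {..<dim_row A})"
    using A by (intro nonneg_fac_trivial[OF K]) (auto simp: matrix_over_def nonneg_matrix_def)
  then have "\<exists>l. ?P l" using nonneg_fac_imp_fact_plus[OF K] by blast
  then have "?P (nonneg_rank A K)" unfolding nonneg_rank_def by (rule LeastI_ex)
  then show "?fac k" using fact_plus_imp_nonneg_fac[OF K] nonneg_fac_mono[OF K _ le] by blast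
next
  assume "?fac k"
  then obtain l where "l \<le> k" and l: "\<exists>Bs\<in>fact_plus A l. \<forall>B\<in>set Bs. matrix_over K B"
    using nonneg_fac_imp_fact_plus[OF K] by blast
  from l have "nonneg_rank A K \<le> l"
    unfolding nonneg_rank_def by (rule Least_le)
  with \<open>l \<le> k\<close> show "nonneg_rank A K \<le> k" by simp
qed

subsection \<open>Freeing entries\<close>

text \<open>For every cell \<open>s = (p, q)\<close> of \<open>S\<close> the matrix is bordered with the cyclic block whose row \<open>r\<close> has
  ones in the columns \<open>r\<close> and \<open>r + 1\<close> modulo 4. It has rank 3 but nonnegative rank 4, and this gap
  leaves one free parameter: the four terms covering the block can absorb any part of the entry at
  \<open>(p, q)\<close>, and they cannot meet the original matrix anywhere else.\<close>

fun cell_gadget ::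
  "('i \<Rightarrow> 'j \<Rightarrow> 'a::linordered_field) \<Rightarrow> 'i + ('i \<times> 'j) \<times> nat \<Rightarrow> 'j + ('i \<times> 'j) \<times> nat \<Rightarrow> 'a" where
  "cell_gadget A (Inl i) (Inl j) = A i j"
| "cell_gadget A (Inl i) (Inr (s, c)) = (if i = fst s \<and> c = 0 then 1 else 0)"
| "cell_gadget A (Inr (s, r)) (Inl j) = (if j = snd s then A (fst s) (snd s) else 0)"
| "cell_gadget A (Inr (s, r)) (Inr (s', c)) =
     (if s = s' \<and> (c = r \<or> c = Suc r mod 4) then 1 else 0)"

text \<open>A factorization of \<open>B\<close> is extended by four terms per cell. Term
  \<open>a\<close> has border column \<open>a\<close> as left factor, and its right factor restricts
  to a unit vector on the border columns. The term with \<open>a = 0\<close> restores the difference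
  of \<open>A\<close> and \<open>B\<close> at the cell.\<close>

lemma nonneg_fac_cell_gadgetI:
  fixes A B :: "'i \<Rightarrow> 'j \<Rightarrow> 'a::linordered_field"
  assumes K: "is_subfield K" and fin: "finite S" and S: "S \<subseteq> I \<times> J"
    and A: "\<And>i j. (i, j) \<in> S \<Longrightarrow> A i j \<in> K"
    and B: "nonneg_fac K I J B k" "\<And>i j. i \<in> I \<Longrightarrow> j \<in> J \<Longrightarrow> (i, j) \<notin> S \<Longrightarrow> B i j = A i j"
      "\<And>i j. (i, j) \<in> S \<Longrightarrow> B i j \<in> K \<and> 0 \<le> B i j \<and> B i j \<le> A i j"
  shows "nonneg_fac K (I <+> S \<times> {..<4}) (J <+> S \<times> {..<4}) (cell_gadget A) (k + 4 * card S)"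
proof -
  obtain f g where *: "\<forall>t<k. (\<forall>i\<in>I. f t i \<in> K \<and> 0 \<le> f t i) \<and> (\<forall>j\<in>J. g t j \<in> K \<and> 0 \<le> g t j)"
    and "\<forall>i\<in>I. \<forall>j\<in>J. B i j = (\<Sum>t<k. f t i * g t j)"
    using B(1) unfolding nonneg_fac_def by (elim exE conjE) (rule that)
  then have fg: "B i j = (\<Sum>t<k. f t i * g t j)" if "i \<in> I" "j \<in> J" for i j
    using that by blast
  have f: "f t i \<in> K \<and> 0 \<le> f t i" if "t < k" "i \<in> I" for t i
    using * that by blast
  have g: "g t j \<in> K \<and> 0 \<le> g t j" if "t < k" "j \<in> J" for t j
    using * that by blast
  define F where "F t i = (case t of
      Inl u \<Rightarrow> (case i of Inl i' \<Rightarrow> f u i' | Inr _ \<Rightarrow> 0)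
    | Inr (s, a) \<Rightarrow> (case i of Inl i' \<Rightarrow> of_bool (i' = fst s \<and> a = 0)
        | Inr (s', r) \<Rightarrow> of_bool (s' = s \<and> (a = r \<or> a = Suc r mod 4))))"
    for t :: "nat + ('i \<times> 'j) \<times> nat" and i :: "'i + ('i \<times> 'j) \<times> nat"
  \<comment> \<open>Any two cyclically adjacent values add up to the entry of \<open>A\<close>, as
    the border rows require; the alternation closes up because 4 is even. The bounds on
    \<open>B\<close> make both values nonnegative.\<close>
  define y where "y s a = (if even a then A (fst s) (snd s) - B (fst s) (snd s) else B (fst s) (snd s))"
    for s and a :: nat
  define G where "G t j = (case t of
      Inl u \<Rightarrow> (case j of Inl j' \<Rightarrow> g u j' | Inr _ \<Rightarrow> 0)
    | Inr (s, a) \<Rightarrow> (case j of Inl j' \<Rightarrow> of_bool (j' = snd s) * y s a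
        | Inr (s', c) \<Rightarrow> of_bool (s' = s \<and> c = a)))"
    for t :: "nat + ('i \<times> 'j) \<times> nat" and j :: "'j + ('i \<times> 'j) \<times> nat"
  show ?thesis
  proof (rule nonneg_facI[OF K, of "{..<k} <+> S \<times> {..<4}" _ _ F _ G])
    show "card ({..<k} <+> S \<times> {..<4::nat}) \<le> k + 4 * card S"
      using fin by (simp add: card_Plus card_cartesian_product)
    show "F t i \<in> K \<and> 0 \<le> F t i"
      if "t \<in> {..<k} <+> S \<times> {..<4}" "i \<in> I <+> S \<times> {..<4}" for t i
      using that f K by (auto simp: F_def is_subfield_def)
    have "y s a \<in> K \<and> 0 \<le> y s a" if "s \<in> S" for s a
      using that A[of "fst s" "snd s"] B(3)[of "fst s" "snd s"] subfield_minus[OF K]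
      by (auto simp: y_def)
    then show "G t j \<in> K \<and> 0 \<le> G t j"
      if "t \<in> {..<k} <+> S \<times> {..<4}" "j \<in> J <+> S \<times> {..<4}" for t j
      using that g K by (auto simp: G_def is_subfield_def)
    have split: "(\<Sum>t\<in>{..<k} <+> S \<times> {..<4}. F t i * G t j) =
        (\<Sum>t<k. F (Inl t) i * G (Inl t) j) + (\<Sum>s\<in>S. \<Sum>a<4. F (Inr (s, a)) i * G (Inr (s, a)) j)"
      for i j
      using fin by (simp add: sum.Plus sum.cartesian_product case_prod_unfold)
    show "cell_gadget A i j = (\<Sum>t\<in>{..<k} <+> S \<times> {..<4}. F t i * G t j)"
      if ij: "i \<in> I <+> S \<times> {..<4}" "j \<in> J <+> S \<times> {..<4}" for i j
    proof -
      have four: "a = 0 \<or> a = 1 \<or> a = 2 \<or> a = 3" if "a < 4" for a :: nat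
        using that by auto
      consider (main) i' j' where "i = Inl i'" "j = Inl j'" "i' \<in> I" "j' \<in> J"
        | (col) i' s c where "i = Inl i'" "j = Inr (s, c)" "s \<in> S" "c < 4"
        | (row) s r j' where "i = Inr (s, r)" "j = Inl j'" "s \<in> S" "r < 4"
        | (block) s r s' c where "i = Inr (s, r)" "j = Inr (s', c)" "s \<in> S" "r < 4" "s' \<in> S" "c < 4"
        using ij by auto
      then show ?thesis
      proof cases
        case main
        have "(\<Sum>a<4. F (Inr (s, a)) i * G (Inr (s, a)) j) =
            (if s = (i', j') then A i' j' - B i' j' else 0)" for s
          by (cases s) (auto simp: main F_def G_def y_def numeral_eq_Suc)
        then have "(\<Sum>s\<in>S. \<Sum>a<4. F (Inr (s, a)) i * G (Inr (s, a)) j) =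
            (if (i', j') \<in> S then A i' j' - B i' j' else 0)"
          using fin by simp
        moreover have "(\<Sum>t<k. F (Inl t) i * G (Inl t) j) = B i' j'"
          using fg[OF main(3,4)] by (simp add: main F_def G_def)
        ultimately show ?thesis
          unfolding split using B(2)[OF main(3,4)] by (simp add: main)
      next
        case col
        have "(\<Sum>a<4. F (Inr (u, a)) i * G (Inr (u, a)) j) =
            (if u = s then if i' = fst s \<and> c = 0 then 1 else 0 else 0)" for u
          using four[OF col(4)] by (auto simp: col F_def G_def numeral_eq_Suc)
        then show ?thesis
          unfolding split using fin col(3) by (simp add: col F_def G_def)
      next
        case row
        have "{..<4} \<inter> {a. a = r \<or> a = Suc r mod 4} = {r, Suc r mod 4}"
          using row(4) by auto
        moreover have "r \<noteq> Suc r mod 4" "even (Suc r mod 4) \<longleftrightarrow> odd r"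
          using row(4) by presburger+
        ultimately have "sum (y s) ({..<4} \<inter> {a. a = r \<or> a = Suc r mod 4}) = A (fst s) (snd s)"
          by (simp add: y_def)
        then have "(\<Sum>a<4. F (Inr (u, a)) i * G (Inr (u, a)) j) =
            (if u = s then if j' = snd s then A (fst s) (snd s) else 0 else 0)" for u
          by (auto simp: row F_def G_def)
        then show ?thesis
          unfolding split using fin row(3) by (simp add: row F_def G_def)
      next
        case block
        have "(\<Sum>a<4. F (Inr (u, a)) i * G (Inr (u, a)) j) =
            (\<Sum>a<4. if a = c then if u = s then cell_gadget A i j else 0 else 0)" for u
          by (rule sum.cong) (auto simp: block F_def G_def)
        then have "(\<Sum>a<4. F (Inr (u, a)) i * G (Inr (u, a)) j) =
            (if u = s then cell_gadget A i j else 0)" for u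
          using block(6) by simp
        then show ?thesis
          unfolding split using fin block(3) by (simp add: block F_def G_def)
      qed
    qed
  qed (use fin in simp)
qed

text \<open>The diagonal entries of all border blocks form a fooling set: no term covers two of
  them. They occupy \<open>4 * card S\<close> terms, which meet the original matrix only in the
  freed cells; \<open>B\<close> is the sum of the other \<open>k\<close> terms.\<close>

lemma nonneg_fac_cell_gadgetD:
  assumes K: "is_subfield K" and fin: "finite S" and S: "S \<subseteq> I \<times> J"
    and fac: "nonneg_fac K (I <+> S \<times> {..<4}) (J <+> S \<times> {..<4}) (cell_gadget A) (k + 4 * card S)"
  obtains B where "nonneg_fac K I J B k"
    "\<And>i j. i \<in> I \<Longrightarrow> j \<in> J \<Longrightarrow> (i, j) \<notin> S \<Longrightarrow> B i j = A i j"
    "\<And>i j. i \<in> I \<Longrightarrow> j \<in> J \<Longrightarrow> B i j \<le> A i j"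
proof -
  let ?I = "I <+> S \<times> {..<4::nat}" and ?J = "J <+> S \<times> {..<4::nat}" and ?N = "k + 4 * card S"
  obtain f g where *: "\<forall>t<?N. (\<forall>i\<in>?I. f t i \<in> K \<and> 0 \<le> f t i) \<and> (\<forall>j\<in>?J. g t j \<in> K \<and> 0 \<le> g t j)"
    and "\<forall>i\<in>?I. \<forall>j\<in>?J. cell_gadget A i j = (\<Sum>t<?N. f t i * g t j)"
    using fac unfolding nonneg_fac_def by (elim exE conjE) (rule that)
  then have fg: "cell_gadget A i j = (\<Sum>t<?N. f t i * g t j)" if "i \<in> ?I" "j \<in> ?J" for i j
    using that by blast
  have f: "f t i \<in> K \<and> 0 \<le> f t i" if "t < ?N" "i \<in> ?I" for t i
    using * that by blast
  have g: "g t j \<in> K \<and> 0 \<le> g t j" if "t < ?N" "j \<in> ?J" for t j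
    using * that by blast
  \<comment> \<open>Nonnegative summands cannot cancel, so every term is supported where the matrix
    is nonzero.\<close>
  have supp: "cell_gadget A i j \<noteq> 0"
    if "t < ?N" "i \<in> ?I" "j \<in> ?J" "f t i \<noteq> 0" "g t j \<noteq> 0" for t i j
  proof -
    have "0 < f t i * g t j"
      using f[OF that(1,2)] g[OF that(1,3)] that(4,5) by simp
    also have "\<dots> \<le> (\<Sum>t<?N. f t i * g t j)"
      using f g that by (intro member_le_sum) auto
    finally show ?thesis using fg[OF that(2,3)] by simp
  qed
  have "\<exists>t<?N. f t (Inr x) \<noteq> 0 \<and> g t (Inr x) \<noteq> 0" if x: "x \<in> S \<times> {..<4}" for x
  proof (rule ccontr)
    assume "\<not> ?thesis"
    then have "(\<Sum>t<?N. f t (Inr x) * g t (Inr x)) = 0" by (intro sum.neutral) auto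
    moreover have "cell_gadget A (Inr x) (Inr x) = 1" by (cases x) simp
    ultimately show False using fg[of "Inr x" "Inr x"] x by (simp add: InrI)
  qed
  then obtain \<tau> where \<tau>: "\<And>x. x \<in> S \<times> {..<4} \<Longrightarrow> \<tau> x < ?N"
      "\<And>x. x \<in> S \<times> {..<4} \<Longrightarrow> f (\<tau> x) (Inr x) \<noteq> 0"
      "\<And>x. x \<in> S \<times> {..<4} \<Longrightarrow> g (\<tau> x) (Inr x) \<noteq> 0"
    by metis
  have inj: "inj_on \<tau> (S \<times> {..<4})"
  proof (rule inj_onI)
    fix x x' assume x: "x \<in> S \<times> {..<4::nat}" "x' \<in> S \<times> {..<4}" "\<tau> x = \<tau> x'"
    then have "cell_gadget A (Inr x) (Inr x') \<noteq> 0" "cell_gadget A (Inr x') (Inr x) \<noteq> 0"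
      using supp[OF \<tau>(1)[OF x(1)]] \<tau>(2,3)[OF x(1)] \<tau>(2,3)[OF x(2)] by auto
    moreover obtain s r s' r' where sr: "x = (s, r)" "x' = (s', r')" by fastforce
    ultimately have "s = s'" "r' = r \<or> r' = Suc r mod 4" "r = r' \<or> r = Suc r' mod 4"
      by (auto split: if_splits)
    moreover have "r < 4" "r' < 4" using x sr by auto
    \<comment> \<open>Two successive cyclic shifts would return to the start only if 4 divided
      2.\<close>
    ultimately have "r = r'" by presburger
    with sr \<open>s = s'\<close> show "x = x'" by simp
  qed
  define D where "D = \<tau> ` (S \<times> {..<4})"
  have D: "D \<subseteq> {..<?N}" "card D = 4 * card S"
    using \<tau>(1) card_image[OF inj] by (auto simp: D_def card_cartesian_product)
  define B where "B i j = (\<Sum>t\<in>{..<?N} - D. f t (Inl i) * g t (Inl j))" for i j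
  \<comment> \<open>A term of \<open>D\<close> is nonzero in a border row and in a border column of
    some \<open>s\<close>. Among the original rows and columns these meet only the row
    \<open>fst s\<close> and the column \<open>snd s\<close>, which confines the term to the cell
    \<open>s\<close>.\<close>
  have zero: "f t (Inl i) * g t (Inl j) = 0"
    if "t \<in> D" "i \<in> I" "j \<in> J" "(i, j) \<notin> S" for t i j
  proof (rule ccontr)
    assume nz: "f t (Inl i) * g t (Inl j) \<noteq> 0"
    from \<open>t \<in> D\<close> obtain x where x: "x \<in> S \<times> {..<4}" "t = \<tau> x" by (auto simp: D_def)
    obtain s r where sr: "x = (s, r)" by (cases x)
    have "cell_gadget A (Inl i) (Inr x) \<noteq> 0" "cell_gadget A (Inr x) (Inl j) \<noteq> 0"
      using supp[OF \<tau>(1)[OF x(1)]] \<tau>(2,3)[OF x(1)] x that nz by auto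
    then have "s = (i, j)" unfolding sr by (auto split: if_splits simp: prod_eq_iff)
    then show False using that(4) x sr by simp
  qed
  have AB: "A i j = B i j + (\<Sum>t\<in>D. f t (Inl i) * g t (Inl j))" if "i \<in> I" "j \<in> J" for i j
  proof -
    have "A i j = (\<Sum>t<?N. f t (Inl i) * g t (Inl j))"
      using fg[of "Inl i" "Inl j"] that by (simp add: InlI)
    then show ?thesis
      unfolding B_def using D(1) by (simp add: sum.subset_diff)
  qed
  have f': "f t (Inl i) \<in> K" "0 \<le> f t (Inl i)" if "t < ?N" "i \<in> I" for t i
    using f[of t "Inl i"] that by auto
  have g': "g t (Inl j) \<in> K" "0 \<le> g t (Inl j)" if "t < ?N" "j \<in> J" for t j
    using g[of t "Inl j"] that by auto
  show thesis
  proof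
    show "nonneg_fac K I J B k"
      using f' g' D by (intro nonneg_facI[OF K, of "{..<?N} - D" _ _ "\<lambda>t i. f t (Inl i)" _ "\<lambda>t j. g t (Inl j)"])
        (auto simp: B_def card_Diff_subset finite_subset)
    show "B i j = A i j" if "i \<in> I" "j \<in> J" "(i, j) \<notin> S" for i j
      using AB[of i j] that zero[of _ i j] by simp
    show "B i j \<le> A i j" if "i \<in> I" "j \<in> J" for i j
      using AB[OF that] that f' g' D(1) by (simp add: sum_nonneg subset_iff)
  qed
qed

subsection \<open>Encoding polynomial inequalities\<close>

lemma nonneg_fac_mem:
  assumes "is_subfield K" "nonneg_fac K I J B k" "i \<in> I" "j \<in> J"
  shows "B i j \<in> K" "0 \<le> B i j"
proof -
  obtain f g where fg: "\<forall>t<k. (\<forall>i\<in>I. f t i \<in> K \<and> 0 \<le> f t i) \<and> (\<forall>j\<in>J. g t j \<in> K \<and> 0 \<le> g t j)"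
    and B: "\<forall>i\<in>I. \<forall>j\<in>J. B i j = (\<Sum>t<k. f t i * g t j)"
    using assms(2) unfolding nonneg_fac_def by (elim exE conjE) (rule that)
  have "(\<Sum>t<k. f t i * g t j) \<in> K"
    using fg assms by (intro subfield_sum[OF assms(1)]) (auto simp: is_subfield_def)
  then show "B i j \<in> K" using B assms by simp
  have "0 \<le> (\<Sum>t<k. f t i * g t j)"
    using fg assms by (intro sum_nonneg) auto
  then show "0 \<le> B i j" using B assms by simp
qed

text \<open>The zeros off the diagonal force the diagonal ones to use distinct terms, and there are
  only \<open>card C\<close> terms, so terms correspond to elements of \<open>C\<close>. Row
  \<open>e c\<close> and column \<open>e' c\<close> receive only the term of \<open>c\<close> and
  hence display its two factors up to scale.\<close>

lemma nonneg_fac_identity_block: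
  assumes fac: "nonneg_fac K I J B (card C)" and C: "finite C"
    and e: "\<And>c. c \<in> C \<Longrightarrow> e c \<in> I" and e': "\<And>c. c \<in> C \<Longrightarrow> e' c \<in> J"
    and block: "\<And>c d. c \<in> C \<Longrightarrow> d \<in> C \<Longrightarrow> B (e c) (e' d) = (if c = d then 1 else 0)"
    and i: "i \<in> I" and j: "j \<in> J"
  shows "B i j = (\<Sum>c\<in>C. B i (e' c) * B (e c) j)"
proof -
  let ?k = "card C"
  obtain f g where fg: "\<forall>t<?k. (\<forall>i\<in>I. f t i \<in> K \<and> 0 \<le> f t i) \<and> (\<forall>j\<in>J. g t j \<in> K \<and> 0 \<le> g t j)"
    and "\<forall>i\<in>I. \<forall>j\<in>J. B i j = (\<Sum>t<?k. f t i * g t j)"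
    using fac unfolding nonneg_fac_def by (elim exE conjE) (rule that)
  then have B: "B i j = (\<Sum>t<?k. f t i * g t j)" if "i \<in> I" "j \<in> J" for i j
    using that by blast
  have zero: "f t (e c) * g t (e' d) = 0" if "t < ?k" "c \<in> C" "d \<in> C" "c \<noteq> d" for t c d
  proof -
    have "(\<Sum>t<?k. f t (e c) * g t (e' d)) = 0"
      unfolding B[OF e[OF that(2)] e'[OF that(3)], symmetric] using block that by simp
    then show ?thesis
      using fg e e' that by (subst (asm) sum_nonneg_eq_0_iff) auto
  qed
  have "\<exists>t<?k. f t (e c) \<noteq> 0 \<and> g t (e' c) \<noteq> 0" if "c \<in> C" for c
  proof (rule ccontr)
    assume "\<not> ?thesis"
    then have "(\<Sum>t<?k. f t (e c) * g t (e' c)) = 0" by (intro sum.neutral) auto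
    then show False using B[OF e[OF that] e'[OF that]] block[OF that that] by simp
  qed
  then obtain \<tau> where \<tau>: "\<And>c. c \<in> C \<Longrightarrow> \<tau> c < ?k" "\<And>c. c \<in> C \<Longrightarrow> f (\<tau> c) (e c) \<noteq> 0"
      "\<And>c. c \<in> C \<Longrightarrow> g (\<tau> c) (e' c) \<noteq> 0"
    by metis
  have inj: "inj_on \<tau> C"
    using zero \<tau> by (metis inj_onI mult_eq_0_iff)
  then have "\<tau> ` C = {..<?k}"
    using \<tau>(1) by (intro card_subset_eq) (auto simp: card_image)
  then have sum_\<tau>: "(\<Sum>t<?k. h t) = (\<Sum>c\<in>C. h (\<tau> c))" for h :: "nat \<Rightarrow> 'a"
    using sum.reindex[OF inj, of h] by (simp add: o_def)
  have zero': "f (\<tau> c) (e d) = 0" "g (\<tau> c) (e' d) = 0" if "c \<in> C" "d \<in> C" "c \<noteq> d" for c d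
    using zero[OF \<tau>(1)[OF that(1)] that(2,1)] zero[OF \<tau>(1)[OF that(1)] that(1,2)] \<tau>(2,3)[OF that(1)] that
    by auto
  have row: "B (e c) j = f (\<tau> c) (e c) * g (\<tau> c) j" if "c \<in> C" "j \<in> J" for c j
    unfolding B[OF e[OF that(1)] that(2)] sum_\<tau> using C that zero' by (simp add: sum.remove[of C c])
  have col: "B i (e' c) = f (\<tau> c) i * g (\<tau> c) (e' c)" if "c \<in> C" "i \<in> I" for c i
    unfolding B[OF that(2) e'[OF that(1)]] sum_\<tau> using C that zero' by (simp add: sum.remove[of C c])
  have "f (\<tau> c) i * g (\<tau> c) j = B i (e' c) * B (e c) j" if "c \<in> C" for c
  proof -
    \<comment> \<open>The two scaling factors cancel, since their product is the diagonal entry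
      1.\<close>
    have "B i (e' c) * B (e c) j = (f (\<tau> c) i * g (\<tau> c) j) * (f (\<tau> c) (e c) * g (\<tau> c) (e' c))"
      by (simp add: row[OF that j] col[OF that i])
    also have "f (\<tau> c) (e c) * g (\<tau> c) (e' c) = 1"
      using row[OF that e'[OF that]] block[OF that that] by simp
    finally show ?thesis by simp
  qed
  then show ?thesis
    unfolding B[OF i j] sum_\<tau> by simp
qed

text \<open>In a factorization of size \<open>card (coords n)\<close> the block of basis rows and basis columns is the identity
  matrix, so every other row and column is a vector over \<open>coords n\<close> and every entry is an inner
  product. With \<open>x\<close> the encoded point, \<open>Power_col\<close> has the coordinates \<open>x ^ i\<close> and \<open>1 - x ^ i\<close>; a step row
  carries an unknown coordinate \<open>w\<close>, which \<open>Step_col\<close> forces to be \<open>x\<close> and \<open>Power_col\<close> turns into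
  \<open>w * x ^ i + (1 - x ^ Suc i) = 1\<close>.\<close>

datatype coord = Power nat | Complement nat | Unit
datatype prow = Basis_row coord | Step_row nat | Complement_row nat | Constraint_row nat
datatype pcol = Basis_col coord | Power_col | Step_col

fun row_vec :: "(nat \<Rightarrow> 'a::linordered_field poly) \<Rightarrow> 'a \<Rightarrow> prow \<Rightarrow> coord \<Rightarrow> 'a" where
  "row_vec Q x (Basis_row c) d = (if d = c then 1 else 0)"
| "row_vec Q x (Step_row i) d =
     (if d = Power i then x else if d = Complement (Suc i) \<or> d = Unit then 1 else 0)"
| "row_vec Q x (Complement_row i) d = (if d = Power i \<or> d = Complement i then 1 else 0)"
| "row_vec Q x (Constraint_row l) (Power i) = max 0 (- coeff (Q l) i)"
| "row_vec Q x (Constraint_row l) (Complement i) = max 0 (coeff (Q l) i)"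
| "row_vec Q x (Constraint_row l) Unit = 0"

fun col_vec :: "'a::linordered_field \<Rightarrow> pcol \<Rightarrow> coord \<Rightarrow> 'a" where
  "col_vec x (Basis_col c) d = (if d = c then 1 else 0)"
| "col_vec x Power_col (Power i) = x ^ i"
| "col_vec x Power_col (Complement i) = 1 - x ^ i"
| "col_vec x Power_col Unit = 0"
| "col_vec x Step_col (Power i) = 1"
| "col_vec x Step_col (Complement i) = 0"
| "col_vec x Step_col Unit = 1 - x"

definition coords :: "nat \<Rightarrow> coord set" where
  "coords n = Power ` {..n} \<union> Complement ` {..n} \<union> {Unit}"

definition pattern_rows :: "nat \<Rightarrow> nat \<Rightarrow> prow set" where
  "pattern_rows n L = Basis_row ` coords n \<union> Step_row ` {..<n} \<union> Complement_row ` {..n} \<union>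
     Constraint_row ` {..<L}"

definition pattern_columns :: "nat \<Rightarrow> pcol set" where
  "pattern_columns n = Basis_col ` coords n \<union> {Power_col, Step_col}"

text \<open>The entries that vary with the encoded point are among these cells.
  \<open>Power 0\<close> is excluded in \<open>Power_col\<close>: its prescribed value 1 starts the
  recursion for the powers.\<close>

fun free_cell :: "nat \<Rightarrow> nat \<Rightarrow> prow \<Rightarrow> pcol \<Rightarrow> bool" where
  "free_cell n L (Basis_row (Power i)) Power_col \<longleftrightarrow> 0 < i \<and> i \<le> n"
| "free_cell n L (Basis_row (Complement i)) Power_col \<longleftrightarrow> i \<le> n"
| "free_cell n L (Basis_row Unit) Step_col \<longleftrightarrow> True"
| "free_cell n L (Step_row i) (Basis_col (Power j)) \<longleftrightarrow> i = j \<and> i < n"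
| "free_cell n L (Constraint_row l) Power_col \<longleftrightarrow> l < L"
| "free_cell n L _ _ \<longleftrightarrow> False"

definition free_cells :: "nat \<Rightarrow> nat \<Rightarrow> (prow \<times> pcol) set" where
  "free_cells n L = {(r, c). free_cell n L r c}"

definition point_matrix ::
  "(nat \<Rightarrow> 'a::linordered_field poly) \<Rightarrow> nat \<Rightarrow> 'a \<Rightarrow> prow \<Rightarrow> pcol \<Rightarrow> 'a" where
  "point_matrix Q n x r c = (\<Sum>d\<in>coords n. row_vec Q x r d * col_vec x c d)"

text \<open>On a free cell the entry is only an upper bound. For a constraint row this bound is the inequality
  \<open>0 \<le> poly (Q l) x\<close>, see \<open>constraint_identity\<close>.\<close>

definition pattern_matrix ::
  "(nat \<Rightarrow> 'a::linordered_field poly) \<Rightarrow> nat \<Rightarrow> nat \<Rightarrow> prow \<Rightarrow> pcol \<Rightarrow> 'a" where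
  "pattern_matrix Q n L r c =
     (if free_cell n L r c
      then case r of Constraint_row l \<Rightarrow> \<Sum>i\<le>n. max 0 (coeff (Q l) i) | _ \<Rightarrow> 1
      else point_matrix Q n 0 r c)"

section \<open>Entries of the matrix of a given point\<close>

lemma sum_coords:
  "(\<Sum>d\<in>coords n. h d) = (\<Sum>i\<le>n. h (Power i)) + (\<Sum>i\<le>n. h (Complement i)) + h Unit"
proof -
  have "(\<Sum>d\<in>coords n. h d) = sum h (Power ` {..n}) + sum h (Complement ` {..n}) + h Unit"
    unfolding coords_def by (subst sum.union_disjoint; (subst sum.union_disjoint)?; auto)
  then show ?thesis by (simp add: sum.reindex inj_on_def)
qed

lemma finite_coords [simp]: "finite (coords n)"
  by (simp add: coords_def)

lemma sum_only:
  "finite A \<Longrightarrow> (\<Sum>i\<in>A. (if i = a then x else 0) * h i) = (if a \<in> A then x * h a else 0)"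
  "finite A \<Longrightarrow> (\<Sum>i\<in>A. h i * (if i = a then x else 0)) = (if a \<in> A then h a * x else 0)"
  for x :: "'a::linordered_field"
  by (simp_all add: if_distrib[of "\<lambda>z. z * _"] if_distrib[of "\<lambda>z. _ * z"] cong: if_cong)

lemma point_matrix_basis:
  "d \<in> coords n \<Longrightarrow> point_matrix Q n x (Basis_row d) c = col_vec x c d"
  "d \<in> coords n \<Longrightarrow> point_matrix Q n x r (Basis_col d) = row_vec Q x r d"
  unfolding point_matrix_def row_vec.simps col_vec.simps
  by (simp_all only: sum_only finite_coords if_True mult_1_left mult_1_right)

lemma point_matrix_step:
  assumes "i < n"
  shows "point_matrix Q n x (Step_row i) Power_col = 1" "point_matrix Q n x (Step_row i) Step_col = 1"
  using assms by (simp_all add: point_matrix_def sum_coords sum_only cong: if_cong)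

lemma point_matrix_complement:
  assumes "i \<le> n"
  shows "point_matrix Q n x (Complement_row i) Power_col = 1"
    "point_matrix Q n x (Complement_row i) Step_col = 1"
  using assms by (simp_all add: point_matrix_def sum_coords sum_only cong: if_cong)

text \<open>Weighting \<open>x ^ i\<close> by the negative part of a coefficient and
  \<open>1 - x ^ i\<close> by the positive part expresses a constant minus \<open>poly q x\<close>
  with nonnegative weights only.\<close>

lemma constraint_identity:
  fixes q :: "'a::linordered_field poly"
  assumes "degree q \<le> n"
  shows "(\<Sum>i\<le>n. max 0 (- coeff q i) * x ^ i) + (\<Sum>i\<le>n. max 0 (coeff q i) * (1 - x ^ i)) =
    (\<Sum>i\<le>n. max 0 (coeff q i)) - poly q x"
proof -
  have "poly q x = (\<Sum>i\<le>n. coeff q i * x ^ i)"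
    unfolding poly_altdef using assms
    by (intro sum.mono_neutral_left) (auto simp: coeff_eq_0)
  moreover have "max 0 (- c) * y + max 0 c * (1 - y) = max 0 c - c * y" for c y :: 'a
    by (simp add: max_def algebra_simps)
  ultimately show ?thesis
    by (simp add: sum.distrib[symmetric] sum_subtractf)
qed

lemma point_matrix_constraint:
  assumes "degree (Q l) \<le> n"
  shows "point_matrix Q n x (Constraint_row l) Power_col =
      (\<Sum>i\<le>n. max 0 (coeff (Q l) i)) - poly (Q l) x"
    "point_matrix Q n x (Constraint_row l) Step_col = (\<Sum>i\<le>n. max 0 (- coeff (Q l) i))"
  using constraint_identity[OF assms, of x] by (simp_all add: point_matrix_def sum_coords)

text \<open>Justifies evaluating the prescribed entries of \<open>pattern_matrix\<close> at the
  point 0.\<close>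

lemma pattern_matrix_hard:
  assumes "\<And>l. l < L \<Longrightarrow> degree (Q l) \<le> n" "r \<in> pattern_rows n L" "c \<in> pattern_columns n" "\<not> free_cell n L r c"
  shows "point_matrix Q n x r c = point_matrix Q n 0 r c"
proof -
  consider (basis) d where "r = Basis_row d" "d \<in> coords n" | (step) i where "r = Step_row i" "i < n"
    | (complement) i where "r = Complement_row i" "i \<le> n"
    | (constraint) l where "r = Constraint_row l" "l < L"
    using assms(2) by (auto simp: pattern_rows_def)
  then show ?thesis
  proof cases
    case basis
    then show ?thesis
      using assms(4) by (cases c; cases d) (auto simp: point_matrix_basis coords_def)
  next
    case step
    show ?thesis
      using assms(3,4) step
      by (auto simp: pattern_columns_def point_matrix_basis point_matrix_step)
  next
    case complement
    then show ?thesis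
      using assms(3) by (auto simp: pattern_columns_def point_matrix_basis point_matrix_complement)
  next
    case constraint
    have "row_vec Q x r d = row_vec Q 0 r d" for d
      unfolding constraint(1) by (cases d) simp_all
    then show ?thesis
      using assms(1,3,4) constraint by (auto simp: pattern_columns_def point_matrix_basis point_matrix_constraint)
  qed
qed

lemma free_cells_subset: "free_cells n L \<subseteq> pattern_rows n L \<times> pattern_columns n"
proof -
  have "r \<in> pattern_rows n L \<and> c \<in> pattern_columns n" if "free_cell n L r c" for r c
    using that by (cases "(n, L, r, c)" rule: free_cell.cases) (auto simp: pattern_rows_def pattern_columns_def coords_def)
  then show ?thesis by (auto simp: free_cells_def)
qed

lemma finite_pattern_rows [simp]: "finite (pattern_rows n L)" and finite_pattern_columns [simp]: "finite (pattern_columns n)"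
  by (simp_all add: pattern_rows_def pattern_columns_def)

lemma finite_free_cells [simp]: "finite (free_cells n L)"
  by (rule finite_subset[OF free_cells_subset]) simp

lemma subfield_max: "is_subfield K \<Longrightarrow> x \<in> K \<Longrightarrow> max 0 x \<in> K \<and> max 0 (- x) \<in> K"
  by (auto simp: is_subfield_def max_def)

lemma row_vec_mem:
  assumes "is_subfield K" "x \<in> K" "0 \<le> x" "\<And>l i. coeff (Q l) i \<in> K"
  shows "row_vec Q x r d \<in> K \<and> 0 \<le> row_vec Q x r d"
  using assms subfield_max[OF assms(1)]
  by (cases r; cases d) (auto simp: is_subfield_def)

lemma col_vec_mem:
  assumes "is_subfield K" "x \<in> K" "0 \<le> x" "x \<le> 1"
  shows "col_vec x c d \<in> K \<and> 0 \<le> col_vec x c d"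
  using assms subfield_minus[OF assms(1)] subfield_power[OF assms(1,2)]
  by (cases c; cases d) (auto simp: is_subfield_def power_le_one)

lemma point_matrix_fac:
  assumes "is_subfield K" "x \<in> K" "0 \<le> x" "x \<le> 1" "\<And>l i. coeff (Q l) i \<in> K"
  shows "nonneg_fac K I J (point_matrix Q n x) (card (coords n))"
  using row_vec_mem[OF assms(1-3,5)] col_vec_mem[OF assms(1-4)]
  by (intro nonneg_facI[OF assms(1), of "coords n" _ _ "\<lambda>d r. row_vec Q x r d" _ "\<lambda>d c. col_vec x c d"])
    (auto simp: point_matrix_def)

lemma pattern_matrix_mem:
  assumes "is_subfield K" "\<And>l i. coeff (Q l) i \<in> K"
  shows "pattern_matrix Q n L r c \<in> K \<and> 0 \<le> pattern_matrix Q n L r c"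
proof -
  have 01: "0 \<in> K" "1 \<in> K" using assms(1) by (auto simp: is_subfield_def)
  have "point_matrix Q n 0 r c \<in> K" "0 \<le> point_matrix Q n 0 r c"
    using nonneg_fac_mem[OF assms(1) point_matrix_fac[OF assms(1) 01(1), where I = UNIV and J = UNIV], of Q] assms(2) by auto
  moreover have "(\<Sum>i\<le>n. max 0 (coeff (Q l) i)) \<in> K" "0 \<le> (\<Sum>i\<le>n. max 0 (coeff (Q l) i))" for l
    using subfield_max[OF assms(1) assms(2)] by (auto intro!: subfield_sum[OF assms(1)] sum_nonneg)
  ultimately show ?thesis
    using 01 by (auto simp: pattern_matrix_def split: prow.split)
qed

lemma point_matrix_le_pattern:
  assumes "\<And>l. l < L \<Longrightarrow> degree (Q l) \<le> n" "\<And>l. l < L \<Longrightarrow> 0 \<le> poly (Q l) x" "0 \<le> x" "x \<le> 1"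
    and "free_cell n L r c"
  shows "point_matrix Q n x r c \<le> pattern_matrix Q n L r c"
  using assms(5) assms(1-4)
  by (cases "(n, L, r, c)" rule: free_cell.cases)
    (auto simp: pattern_matrix_def point_matrix_basis coords_def point_matrix_constraint power_le_one)

section \<open>From a completion to a solution of the inequalities\<close>

text \<open>By the identity block every prescribed entry is an equation between free entries.
  Complement and step rows force the entries of \<open>Power_col\<close> to be powers of one element
  \<open>x\<close>; the bounds on the constraint rows then become the inequalities.\<close>

lemma pattern_completion_point:
  assumes K: "is_subfield K" and deg: "\<And>l. l < L \<Longrightarrow> degree (Q l) \<le> n"
    and fac: "nonneg_fac K (pattern_rows n L) (pattern_columns n) B (card (coords n))"
    and hard: "\<And>r c. r \<in> pattern_rows n L \<Longrightarrow> c \<in> pattern_columns n \<Longrightarrow> \<not> free_cell n L r c \<Longrightarrow>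
      B r c = pattern_matrix Q n L r c"
    and le: "\<And>r c. r \<in> pattern_rows n L \<Longrightarrow> c \<in> pattern_columns n \<Longrightarrow> B r c \<le> pattern_matrix Q n L r c"
  shows "\<exists>x\<in>K. 0 \<le> x \<and> x \<le> 1 \<and> (\<forall>l<L. 0 \<le> poly (Q l) x)"
proof -
  have hard': "B r c = point_matrix Q n 0 r c"
    if "r \<in> pattern_rows n L" "c \<in> pattern_columns n" "\<not> free_cell n L r c" for r c
    using hard[OF that] that by (simp add: pattern_matrix_def)
  have basis: "Basis_row d \<in> pattern_rows n L" "Basis_col d \<in> pattern_columns n" if "d \<in> coords n" for d
    using that by (auto simp: pattern_rows_def pattern_columns_def)
  have cols: "Power_col \<in> pattern_columns n" "Step_col \<in> pattern_columns n" by (auto simp: pattern_columns_def)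
  have unit: "Unit \<in> coords n" by (simp add: coords_def)
  have power: "Power i \<in> coords n" "Complement i \<in> coords n" "Complement_row i \<in> pattern_rows n L" if "i \<le> n" for i
    using that by (auto simp: coords_def pattern_rows_def)
  have decomp: "B r c = (\<Sum>d\<in>coords n. B r (Basis_col d) * B (Basis_row d) c)"
    if "r \<in> pattern_rows n L" "c \<in> pattern_columns n" for r c
  proof (rule nonneg_fac_identity_block[OF fac _ _ _ _ that])
    show "B (Basis_row c) (Basis_col d) = (if c = d then 1 else 0)"
      if "c \<in> coords n" "d \<in> coords n" for c d
      using hard'[OF basis(1)[OF that(1)] basis(2)[OF that(2)]] that
      by (auto simp: point_matrix_basis)
  qed (use basis in auto)
  \<comment> \<open>In the intended completion this cell holds \<open>1 - x\<close>. Its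
    nonnegativity and its upper bound 1 place \<open>x\<close> in the unit interval.\<close>
  define x where "x = 1 - B (Basis_row Unit) Step_col"
  have xK: "x \<in> K"
    unfolding x_def using K nonneg_fac_mem[OF K fac basis(1)[OF unit] cols(2)] subfield_minus[OF K]
    by (auto simp: is_subfield_def)
  have "x \<le> 1"
    unfolding x_def using nonneg_fac_mem[OF K fac basis(1)[OF unit] cols(2)] by simp
  have "0 \<le> x"
    unfolding x_def using le[OF basis(1)[OF unit] cols(2)]
    by (simp add: pattern_matrix_def)
  have col_power: "B (Complement_row i) (Basis_col d) = (if d = Power i \<or> d = Complement i then 1 else 0)"
    if "i \<le> n" "d \<in> coords n" for i d
    using hard'[OF power(3)[OF that(1)] basis(2)[OF that(2)]] that
    by (auto simp: point_matrix_basis)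
  have complement: "B (Basis_row (Power i)) Power_col + B (Basis_row (Complement i)) Power_col = 1"
    if "i \<le> n" for i
  proof -
    have "B (Complement_row i) Power_col = 1"
      using hard'[OF power(3)[OF that] cols(1)] that
      by (auto simp: point_matrix_complement)
    moreover have "B (Complement_row i) Power_col =
        (\<Sum>d\<in>coords n. (if d = Power i \<or> d = Complement i then 1 else 0) * B (Basis_row d) Power_col)"
      unfolding decomp[OF power(3)[OF that] cols(1)] using col_power[OF that] by (intro sum.cong) auto
    ultimately show ?thesis
      using that by (simp add: sum_coords sum_only cong: if_cong)
  qed
  have unit_power: "B (Basis_row Unit) Power_col = 0"
    using hard'[OF basis(1)[OF unit] cols(1)] by (auto simp: point_matrix_basis unit)
  have step: "B (Basis_row (Power (Suc i))) Power_col = x * B (Basis_row (Power i)) Power_col"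
    if "i < n" for i
  proof -
    let ?r = "Step_row i"
    have r: "?r \<in> pattern_rows n L" using that by (simp add: pattern_rows_def)
    \<comment> \<open>The single unknown of the step row. The prescribed entry in
      \<open>Step_col\<close> gives \<open>w + (1 - x) = 1\<close>, so \<open>w = x\<close>; the one
      in \<open>Power_col\<close>, together with \<open>complement\<close>, then gives the
      recursion.\<close>
    define w where "w = B ?r (Basis_col (Power i))"
    have entries: "B ?r (Basis_col d) =
        (if d = Power i then w else if d = Complement (Suc i) \<or> d = Unit then 1 else 0)"
      if "d \<in> coords n" for d
      using hard'[OF r basis(2)[OF that]] that
      by (cases d) (auto simp: point_matrix_basis w_def)
    have sum: "B ?r c = (\<Sum>d\<in>coords n. (if d = Power i then w
        else if d = Complement (Suc i) \<or> d = Unit then 1 else 0) * B (Basis_row d) c)"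
      if "c \<in> pattern_columns n" for c
      unfolding decomp[OF r that] using entries by (intro sum.cong) auto
    have "B ?r Step_col = 1" "B ?r Power_col = 1"
      using hard'[OF r cols(1)] hard'[OF r cols(2)] that by (auto simp: point_matrix_step)
    moreover have "B (Basis_row (Power i)) Step_col = 1" "B (Basis_row (Complement (Suc i))) Step_col = 0"
      using that hard'[OF basis(1)[OF power(1)[of i]] cols(2)] hard'[OF basis(1)[OF power(2)[of "Suc i"]] cols(2)]
      by (auto simp: point_matrix_basis power)
    ultimately have "w + B (Basis_row Unit) Step_col = 1"
      "w * B (Basis_row (Power i)) Power_col + B (Basis_row (Complement (Suc i))) Power_col = 1"
      using sum[OF cols(1)] sum[OF cols(2)] that unit_power
      by (simp_all add: sum_coords sum_only cong: if_cong)
    then have "w = x" "B (Basis_row (Power (Suc i))) Power_col = w * B (Basis_row (Power i)) Power_col"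
      using complement[of "Suc i"] that unfolding x_def by linarith+
    then show ?thesis by simp
  qed
  have zero: "B (Basis_row (Power 0)) Power_col = 1"
    using hard'[OF basis(1)[OF power(1)[of 0]] cols(1)]
    by (auto simp: point_matrix_basis power)
  have powers: "B (Basis_row (Power i)) Power_col = x ^ i" if "i \<le> n" for i
    using that by (induction i) (simp_all add: zero step)
  then have complements: "B (Basis_row (Complement i)) Power_col = 1 - x ^ i" if "i \<le> n" for i
    using complement[OF that] that by (simp add: algebra_simps)
  have "0 \<le> poly (Q l) x" if "l < L" for l
  proof -
    let ?r = "Constraint_row l"
    have r: "?r \<in> pattern_rows n L" using that by (simp add: pattern_rows_def)
    have entries: "B ?r (Basis_col d) = row_vec Q 0 ?r d" if "d \<in> coords n" for d
      using hard'[OF r basis(2)[OF that]] that by (auto simp: point_matrix_basis)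
    have "B ?r Power_col = (\<Sum>d\<in>coords n. row_vec Q 0 ?r d * B (Basis_row d) Power_col)"
      unfolding decomp[OF r cols(1)] using entries by simp
    also have "\<dots> = (\<Sum>i\<le>n. max 0 (coeff (Q l) i)) - poly (Q l) x"
      using constraint_identity[OF deg[OF that], of x]
      by (simp add: sum_coords powers complements unit_power)
    finally show ?thesis
      using le[OF r cols(1)] that by (simp add: pattern_matrix_def)
  qed
  with xK \<open>0 \<le> x\<close> \<open>x \<le> 1\<close> show ?thesis by blast
qed

text \<open>Combines the two layers. It is essential that \<open>A\<close> and \<open>N\<close> are
  chosen before \<open>K\<close>, so that one matrix can compare different fields.\<close>

theorem nonneg_rank_encodes_inequalities:
  fixes Q :: "nat \<Rightarrow> 'a::linordered_field poly"
  assumes F: "is_subfield F" and Q: "\<And>l i. coeff (Q l) i \<in> F"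
  obtains A N where "matrix_over F A" "nonneg_matrix A"
    "\<And>K. is_subfield K \<Longrightarrow> F \<subseteq> K \<Longrightarrow>
      nonneg_rank A K \<le> N \<longleftrightarrow> (\<exists>x\<in>K. 0 \<le> x \<and> x \<le> 1 \<and> (\<forall>l<L. 0 \<le> poly (Q l) x))"
proof -
  define n where "n = (\<Sum>l<L. degree (Q l))"
  have deg: "degree (Q l) \<le> n" if "l < L" for l
    unfolding n_def using that by (intro member_le_sum) auto
  let ?M = "pattern_matrix Q n L" and ?S = "free_cells n L"
  let ?I = "pattern_rows n L" and ?J = "pattern_columns n"
  let ?I' = "?I <+> ?S \<times> {..<4::nat}" and ?J' = "?J <+> ?S \<times> {..<4::nat}"
  \<comment> \<open>One term for each coordinate of the identity block and four for each freed
    cell.\<close>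
  let ?N = "card (coords n) + 4 * card ?S"
  have M: "?M r c \<in> F" "0 \<le> ?M r c" for r c
    using pattern_matrix_mem[OF F Q] by auto
  have G: "cell_gadget ?M i j \<in> F \<and> 0 \<le> cell_gadget ?M i j" for i j
    using F M by (cases "(?M, i, j)" rule: cell_gadget.cases) (auto simp: is_subfield_def)
  have "finite ?I'" "finite ?J'" by simp_all
  \<comment> \<open>The bijections number the rows and columns of the gadget, which are indexed by
    sum types.\<close>
  then obtain e e' where e: "bij_betw e {..<card ?I'} ?I'" and e': "bij_betw e' {..<card ?J'} ?J'"
    using ex_bij_betw_nat_finite by (metis atLeast0LessThan)
  define A where "A = mat (card ?I') (card ?J') (\<lambda>(i, j). cell_gadget ?M (e i) (e' j))"
  have fac_iff: "nonneg_fac K {..<dim_row A} {..<dim_col A} (\<lambda>i j. A $$ (i, j)) k \<longleftrightarrow>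
      nonneg_fac K ?I' ?J' (cell_gadget ?M) k" for K k
  proof
    assume "nonneg_fac K {..<dim_row A} {..<dim_col A} (\<lambda>i j. A $$ (i, j)) k"
    then show "nonneg_fac K ?I' ?J' (cell_gadget ?M) k"
    proof (rule nonneg_fac_reindex)
      show i: "inv_into {..<card ?I'} e i \<in> {..<dim_row A}" if "i \<in> ?I'" for i
        using bij_betw_apply[OF bij_betw_inv_into[OF e] that] by (simp add: A_def)
      show j: "inv_into {..<card ?J'} e' j \<in> {..<dim_col A}" if "j \<in> ?J'" for j
        using bij_betw_apply[OF bij_betw_inv_into[OF e'] that] by (simp add: A_def)
      show "cell_gadget ?M i j = A $$ (inv_into {..<card ?I'} e i, inv_into {..<card ?J'} e' j)"
        if "i \<in> ?I'" "j \<in> ?J'" for i j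
        using i[OF that(1)] j[OF that(2)] bij_betw_inv_into_right[OF e that(1)]
          bij_betw_inv_into_right[OF e' that(2)] by (simp add: A_def)
    qed
  next
    assume "nonneg_fac K ?I' ?J' (cell_gadget ?M) k"
    then show "nonneg_fac K {..<dim_row A} {..<dim_col A} (\<lambda>i j. A $$ (i, j)) k"
      by (rule nonneg_fac_reindex[where e = e and e' = e'])
        (use bij_betw_apply[OF e] bij_betw_apply[OF e'] in \<open>auto simp: A_def\<close>)
  qed
  have "matrix_over F A" "nonneg_matrix A"
    using G by (auto simp: matrix_over_def nonneg_matrix_def A_def)
  then show thesis
  proof (rule that[of A ?N])
    fix K assume K: "is_subfield K" "F \<subseteq> K"
    have "nonneg_rank A K \<le> ?N \<longleftrightarrow> nonneg_fac K ?I' ?J' (cell_gadget ?M) ?N"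
      using \<open>matrix_over F A\<close> \<open>nonneg_matrix A\<close> K
      by (subst nonneg_rank_le_iff) (auto simp: fac_iff matrix_over_def)
    also have "\<dots> \<longleftrightarrow> (\<exists>x\<in>K. 0 \<le> x \<and> x \<le> 1 \<and> (\<forall>l<L. 0 \<le> poly (Q l) x))"
    proof
      assume "nonneg_fac K ?I' ?J' (cell_gadget ?M) ?N"
      then obtain B where "nonneg_fac K ?I ?J B (card (coords n))"
        "\<And>r c. r \<in> ?I \<Longrightarrow> c \<in> ?J \<Longrightarrow> (r, c) \<notin> ?S \<Longrightarrow> B r c = ?M r c"
        "\<And>r c. r \<in> ?I \<Longrightarrow> c \<in> ?J \<Longrightarrow> B r c \<le> ?M r c"
        using nonneg_fac_cell_gadgetD[OF K(1) finite_free_cells free_cells_subset] by metis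
      then show "\<exists>x\<in>K. 0 \<le> x \<and> x \<le> 1 \<and> (\<forall>l<L. 0 \<le> poly (Q l) x)"
        using pattern_completion_point[where Q = Q and B = B, OF K(1) deg] by (simp add: free_cells_def)
    next
      assume "\<exists>x\<in>K. 0 \<le> x \<and> x \<le> 1 \<and> (\<forall>l<L. 0 \<le> poly (Q l) x)"
      then obtain x where x: "x \<in> K" "0 \<le> x" "x \<le> 1" "\<And>l. l < L \<Longrightarrow> 0 \<le> poly (Q l) x" by blast
      have QK: "coeff (Q l) i \<in> K" for l i using Q K(2) by blast
      note fac = point_matrix_fac[where I = ?I and J = ?J and n = n and Q = Q, OF K(1) x(1-3) QK]
      show "nonneg_fac K ?I' ?J' (cell_gadget ?M) ?N"
      proof (rule nonneg_fac_cell_gadgetI[OF K(1) finite_free_cells free_cells_subset _ fac])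
        show "?M r c \<in> K" for r c using M K(2) by blast
        show "point_matrix Q n x r c = ?M r c" if "r \<in> ?I" "c \<in> ?J" "(r, c) \<notin> ?S" for r c
          using pattern_matrix_hard[where Q = Q and x = x, OF deg that(1,2)] that(3)
          by (simp add: free_cells_def pattern_matrix_def)
        show "point_matrix Q n x r c \<in> K \<and> 0 \<le> point_matrix Q n x r c \<and> point_matrix Q n x r c \<le> ?M r c"
          if "(r, c) \<in> ?S" for r c
        proof -
          have rc: "r \<in> ?I" "c \<in> ?J" "free_cell n L r c"
            using that free_cells_subset by (auto simp: free_cells_def)
          then show ?thesis
            using nonneg_fac_mem[OF K(1) fac rc(1,2)]
              point_matrix_le_pattern[where Q = Q and x = x, OF deg x(4) x(2,3) rc(3)] by blast
        qed
      qed
    qed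
    finally show "nonneg_rank A K \<le> ?N \<longleftrightarrow> (\<exists>x\<in>K. 0 \<le> x \<and> x \<le> 1 \<and> (\<forall>l<L. 0 \<le> poly (Q l) x))" .
  qed
qed

subsection \<open>Separating subfields\<close>

text \<open>Derivatives beyond the degree satisfy every weak sign condition, so finitely many
  inequalities suffice for Thom's lemma.\<close>

lemma higher_pderiv_eq_0:
  fixes p :: "'a::linordered_field poly"
  assumes "degree p < i"
  shows "(pderiv ^^ i) p = 0"
  using assms
proof (induction i arbitrary: p)
  case (Suc i)
  show ?case
  proof (cases "degree p = 0")
    case True
    then have "pderiv p = 0" by (simp add: pderiv_eq_0_iff)
    then show ?thesis by (induction i) (simp_all add: funpow_swap1)
  next
    case False
    then show ?thesis
      using Suc.IH[of "pderiv p"] Suc.prems by (simp add: degree_pderiv funpow_swap1)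
  qed
qed simp

text \<open>Absolute value and inversion stay inside a subfield and can be undone in it up to sign,
  so they also preserve being outside \<open>F\<^sub>2\<close>.\<close>

lemma subfield_unit_interval_witness:
  fixes F\<^sub>1 F\<^sub>2 :: "'a::linordered_field set"
  assumes "is_subfield F\<^sub>1" "is_subfield F\<^sub>2" "a \<in> F\<^sub>1" "a \<notin> F\<^sub>2"
  obtains b where "b \<in> F\<^sub>1" "b \<notin> F\<^sub>2" "0 \<le> b" "b \<le> 1"
proof -
  have abs: "\<bar>a\<bar> \<in> F\<^sub>1" "\<bar>a\<bar> \<notin> F\<^sub>2"
    using assms unfolding is_subfield_def abs_if by (metis minus_minus)+
  show thesis
  proof (cases "\<bar>a\<bar> \<le> 1")
    case True
    then show thesis using abs that[of "\<bar>a\<bar>"] by simp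
  next
    case False
    then have "inverse \<bar>a\<bar> \<le> 1"
      by (simp add: inverse_le_1_iff)
    moreover have "inverse \<bar>a\<bar> \<in> F\<^sub>1" "inverse \<bar>a\<bar> \<notin> F\<^sub>2"
      using abs assms(1,2) inverse_inverse_eq[of "\<bar>a\<bar>"] unfolding is_subfield_def by metis+
    ultimately show thesis using that[of "inverse \<bar>a\<bar>"] by simp
  qed
qed

lemma nonneg_rank_separates:
  fixes F F\<^sub>1 F\<^sub>2 :: "'a::linordered_field set"
  assumes F: "is_subfield F" "\<And>x. algebraic_over F x"
    and F\<^sub>1: "is_subfield F\<^sub>1" "F \<subseteq> F\<^sub>1" and F\<^sub>2: "is_subfield F\<^sub>2" "F \<subseteq> F\<^sub>2"
    and "a \<in> F\<^sub>1" "a \<notin> F\<^sub>2"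
  shows "\<exists>A. matrix_over F A \<and> nonneg_matrix A \<and> nonneg_rank A F\<^sub>1 \<noteq> nonneg_rank A F\<^sub>2"
proof -
  obtain b where b: "b \<in> F\<^sub>1" "b \<notin> F\<^sub>2" "0 \<le> b" "b \<le> 1"
    using subfield_unit_interval_witness[OF F\<^sub>1(1) F\<^sub>2(1) assms(7,8)] .
  obtain p where p: "p \<noteq> 0" "\<And>i. coeff p i \<in> F" "poly p b = 0"
    using F(2)[of b] by (auto simp: algebraic_over_def)
  \<comment> \<open>A vanishing derivative receives the sign 1; only the weak condition at
    \<open>b\<close> matters.\<close>
  define s :: "nat \<Rightarrow> 'a" where "s i = (if 0 \<le> poly ((pderiv ^^ i) p) b then 1 else - 1)" for i
  \<comment> \<open>By Thom's lemma, \<open>b\<close> is the only common solution of the inequalities \<open>0 \<le> poly (Q l) x\<close>.\<close>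
  define Q where "Q l = (if l = 0 then p else if l = 1 then - p
    else Polynomial.smult (s (l - 2)) ((pderiv ^^ (l - 2)) p))" for l
  \<comment> \<open>Two inequalities express \<open>p = 0\<close>, and \<open>degree p + 1\<close>
    more cover the derivatives of orders 0 to \<open>degree p\<close>.\<close>
  let ?L = "degree p + 3"
  have s: "s i \<in> F" "s i = 1 \<or> s i = - 1" "0 \<le> s i * poly ((pderiv ^^ i) p) b" for i
    using F(1) by (auto simp: s_def is_subfield_def)
  have "coeff (Q l) i \<in> F" for l i
    using p(2) s(1) subfield_higher_pderiv[OF F(1) p(2)] F(1) by (auto simp: Q_def is_subfield_def)
  then obtain A N where A: "matrix_over F A" "nonneg_matrix A"
    "\<And>K. is_subfield K \<Longrightarrow> F \<subseteq> K \<Longrightarrow>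
      nonneg_rank A K \<le> N \<longleftrightarrow> (\<exists>x\<in>K. 0 \<le> x \<and> x \<le> 1 \<and> (\<forall>l<?L. 0 \<le> poly (Q l) x))"
    using nonneg_rank_encodes_inequalities[OF F(1), of Q ?L] by metis
  have "0 \<le> poly (Q l) b" for l
    using p(3) s(3) by (simp add: Q_def)
  then have "nonneg_rank A F\<^sub>1 \<le> N"
    using A(3)[OF F\<^sub>1] b by blast
  moreover have "\<not> nonneg_rank A F\<^sub>2 \<le> N"
  proof
    assume "nonneg_rank A F\<^sub>2 \<le> N"
    then obtain x where x: "x \<in> F\<^sub>2" "\<And>l. l < ?L \<Longrightarrow> 0 \<le> poly (Q l) x"
      using A(3)[OF F\<^sub>2] by blast
    have sx: "0 \<le> s i * poly ((pderiv ^^ i) p) x" for i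
      using x(2)[of "i + 2"] higher_pderiv_eq_0[of p i] by (cases "i \<le> degree p") (simp_all add: Q_def)
    have "poly p x = 0"
      using x(2)[of 0] x(2)[of 1] by (simp add: Q_def)
    then have "x = b"
      by (rule thom_unique_root[OF p(1) s(2) _ p(3) sx s(3)])
    with x(1) b(2) show False by simp
  qed
  ultimately show ?thesis using A(1,2) by metis
qed

theorem corollary3:
  fixes F F\<^sub>1 F\<^sub>2 :: "'r::linordered_field set"
  assumes "has_real_closure_UNIV F"
    and "is_subfield F\<^sub>1" and "F \<subseteq> F\<^sub>1"
    and "is_subfield F\<^sub>2" and "F \<subseteq> F\<^sub>2"
    and "F\<^sub>1 \<noteq> F\<^sub>2"
  shows "\<exists>A::'r mat. matrix_over F A \<and> nonneg_matrix A \<and> nonneg_rank A F\<^sub>1 \<noteq> nonneg_rank A F\<^sub>2"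
proof -
  have F: "is_subfield F" "\<And>x. algebraic_over F x"
    using assms(1) by (auto simp: has_real_closure_UNIV_def)
  \<comment> \<open>The conclusion is symmetric in the two fields, so the second case is the first
    with their roles exchanged.\<close>
  consider a where "a \<in> F\<^sub>1" "a \<notin> F\<^sub>2" | a where "a \<in> F\<^sub>2" "a \<notin> F\<^sub>1"
    using assms(6) by blast
  then show ?thesis
    using nonneg_rank_separates[OF F] assms(2-5) by cases metis+
qed

end
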